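(* The tile number and the minimal mosaic tile number of each of the trefoil knot $3_1$, the Hopf link $2^2_1$, and Solomon's knot $4^2_1$ equal $12$: $t(3_1)=t(2^2_1)=t(4^2_1)=12$ and $t_M(3_1)=t_M(2^2_1)=t_M(4^2_1)=12$.
   Context: Mosaic tiles: eleven unit squares. $T_0$ is blank. $T_1,T_2,T_3,T_4$ are single arc tiles: $T_1$ joins the midpoints of the left and bottom sides, $T_2$ bottom and right, $T_3$ right and top, $T_4$ top and left. $T_5$ is a horizontal segment tile (left to right), $T_6$ a vertical segment tile (top to bottom). $T_7,T_8$ are the two double arc tiles (one has left-bottom and top-right arcs, the other left-top and bottom-right arcs). $T_9,T_{10}$ are the two crossing tiles (a horizontal and a vertical strand crossing, one for each crossing type). Tiles other than $T_0$ are non-blank. A connection point of a tile is a midpoint of a tile edge that is also an endpoint of a curve drawn on the tile. A tile is suitably connected if each of its connection points touches a connection point of an adjacent tile. An $n$-mosaic is an $n\times n$ array of tiles each of which is suitably connected; it depicts a knot or link diagram. The mosaic number $m(K)$ of a knot or link $K$ is the smallest integer $n$ for which $K$ can be represented as an $n$-mosaic. The tile number of a mosaic is its number of non-blank tiles. The tile number $t(K)$ is the smallest tile number among all mosaics (of any size) representing $K$. The minimal mosaic tile number $t_M(K)$ is the smallest tile number among all $m(K)$-mosaics representing $K$. Knots and links are named as in the standard Alexander–Briggs/Rolfsen tables; Solomon's knot $4^2_1$ is a two-component link. *)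

theory Defs
  imports Main
begin

subsection \<open>Link diagrams\<close>

text \<open>
  A link diagram is drawn in general position with respect to the vertical direction and recorded
  as the list of its critical levels, read downwards.  Just above a level the diagram consists of
  some number of strands, numbered \<open>0, 1, \<dots>\<close> from left to right.  A level \<open>(a, p)\<close> is one of:
  \<^item> \<open>Birth\<close>: a local maximum, whose two legs become the strands \<open>p\<close> and \<open>p + 1\<close>;
  \<^item> \<open>Death\<close>: a local minimum, joining the strands \<open>p\<close> and \<open>p + 1\<close>;
  \<^item> \<open>Cross b\<close>: the strands \<open>p\<close> and \<open>p + 1\<close> cross, and the one running from upper left to
    lower right is the overstrand iff \<open>b\<close>.

  Links are unoriented.
\<close>

datatype event = Birth | Death | Cross bool

fun strands_in :: "event \<Rightarrow> nat" where
  "strands_in Birth = 0"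
| "strands_in Death = 2"
| "strands_in (Cross b) = 2"

fun strands_out :: "event \<Rightarrow> nat" where
  "strands_out Birth = 2"
| "strands_out Death = 0"
| "strands_out (Cross b) = 2"

type_synonym diagram = "(event \<times> nat) list"

text \<open>\<open>leads k w m\<close>: starting from \<open>k\<close> strands, all levels of \<open>w\<close> make sense and leave \<open>m\<close> strands.\<close>

fun leads :: "nat \<Rightarrow> diagram \<Rightarrow> nat \<Rightarrow> bool" where
  "leads k [] m \<longleftrightarrow> k = m"
| "leads k ((a, p) # w) m \<longleftrightarrow>
     p + strands_in a \<le> k \<and> leads (k - strands_in a + strands_out a) w m"

definition link_diagram :: "diagram \<Rightarrow> bool" where
  "link_diagram w \<longleftrightarrow> leads 0 w 0"

text \<open>
  Two diagrams depict the same link (up to ambient isotopy of 3-space) iff they are related by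
  planar isotopies and the three Reidemeister moves.  For diagrams in the above form, planar
  isotopies are generated by \<open>interchange\<close> (two levels involving disjoint sets of strands trade
  places), \<open>zigzag\<close> (a neighbouring maximum and minimum cancel) and \<open>slide\<close> (a strand crossing one
  leg of an extremum is pushed over to the other leg).
\<close>

inductive local_move :: "diagram \<Rightarrow> diagram \<Rightarrow> bool" where
  interchange: "p + strands_out a \<le> q \<Longrightarrow>
     local_move [(a, p), (b, q)] [(b, q + strands_in a - strands_out a), (a, p)]"
| zigzag_left: "local_move [(Birth, i), (Death, i + 1)] []"
| zigzag_right: "local_move [(Birth, i + 1), (Death, i)] []"
| slide_max: "local_move [(Birth, i + 1), (Cross b, i)] [(Birth, i), (Cross (\<not> b), i + 1)]"
| slide_min: "local_move [(Cross b, i), (Death, i + 1)] [(Cross (\<not> b), i + 1), (Death, i)]"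
| R1_max: "local_move [(Birth, i), (Cross b, i)] [(Birth, i)]"
| R1_min: "local_move [(Cross b, i), (Death, i)] [(Death, i)]"
| R2: "local_move [(Cross b, i), (Cross (\<not> b), i)] []"
  \<comment> \<open>The side condition says that the three strands lie at different heights: it excludes
      exactly the two crossing patterns in which they lie cyclically above one another.\<close>
| R3: "b = a \<or> b = c \<Longrightarrow>
     local_move [(Cross a, i), (Cross b, i + 1), (Cross c, i)]
                [(Cross c, i + 1), (Cross b, i), (Cross a, i + 1)]"

inductive move :: "diagram \<Rightarrow> diagram \<Rightarrow> bool" where
  "local_move l r \<Longrightarrow> link_diagram (u @ l @ v) \<Longrightarrow> link_diagram (u @ r @ v) \<Longrightarrow>
     move (u @ l @ v) (u @ r @ v)"

type_synonym link = "diagram set"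

text \<open>The link depicted by a diagram, as the set of all its diagrams.\<close>

definition link_of :: "diagram \<Rightarrow> link" where
  "link_of D = {D'. link_diagram D' \<and> equivclp move D D'}"

text \<open>
  The standard closure of the 2-braid with \<open>k\<close> equal crossings.  The tables list links up to mirror
  image; \<open>b\<close> selects one of the two mirror images.
\<close>

definition closed_2_braid :: "bool \<Rightarrow> nat \<Rightarrow> diagram" where
  "closed_2_braid b k =
     [(Birth, 0), (Birth, 1)] @ replicate k (Cross b, 0) @ [(Death, 1), (Death, 0)]"

definition trefoil_knot :: "bool \<Rightarrow> link" where
  "trefoil_knot b = link_of (closed_2_braid b 3)"

definition hopf_link :: "bool \<Rightarrow> link" where
  "hopf_link b = link_of (closed_2_braid b 2)"

definition solomon_knot :: "bool \<Rightarrow> link" where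
  "solomon_knot b = link_of (closed_2_braid b 4)"


subsection \<open>Mosaics\<close>

datatype tile = T0 | T1 | T2 | T3 | T4 | T5 | T6 | T7 | T8 | T9 | T10

datatype side = Left | Right | Top | Bottom

text \<open>The sides of a tile whose midpoints are connection points.\<close>

fun conn :: "tile \<Rightarrow> side set" where
  "conn T0 = {}"
| "conn T1 = {Left, Bottom}"
| "conn T2 = {Bottom, Right}"
| "conn T3 = {Right, Top}"
| "conn T4 = {Top, Left}"
| "conn T5 = {Left, Right}"
| "conn T6 = {Top, Bottom}"
| "conn T7 = {Left, Right, Top, Bottom}"
| "conn T8 = {Left, Right, Top, Bottom}"
| "conn T9 = {Left, Right, Top, Bottom}"
| "conn T10 = {Left, Right, Top, Bottom}"

text \<open>
  \<open>M i j\<close> is the tile in row \<open>i\<close> (from the top) and column \<open>j\<close> (from the left); only the values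
  for \<open>i, j < n\<close> belong to an \<open>n \<times> n\<close> array.
\<close>

type_synonym tiling = "nat \<Rightarrow> nat \<Rightarrow> tile"

definition suitably_connected :: "nat \<Rightarrow> tiling \<Rightarrow> nat \<Rightarrow> nat \<Rightarrow> bool" where
  "suitably_connected n M i j \<longleftrightarrow>
     (Left \<in> conn (M i j) \<longrightarrow> 0 < j \<and> Right \<in> conn (M i (j - 1))) \<and>
     (Right \<in> conn (M i j) \<longrightarrow> j + 1 < n \<and> Left \<in> conn (M i (j + 1))) \<and>
     (Top \<in> conn (M i j) \<longrightarrow> 0 < i \<and> Bottom \<in> conn (M (i - 1) j)) \<and>
     (Bottom \<in> conn (M i j) \<longrightarrow> i + 1 < n \<and> Top \<in> conn (M (i + 1) j))"

definition mosaic :: "nat \<Rightarrow> tiling \<Rightarrow> bool" where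
  "mosaic n M \<longleftrightarrow> (\<forall>i<n. \<forall>j<n. suitably_connected n M i j)"

text \<open>
  To read off the diagram drawn on a mosaic, turn it clockwise by 45 degrees, so that the left and
  top sides of every tile are its upper sides (in this order from left to right) and the bottom and
  right sides its lower ones.  Then \<open>T2\<close> is a maximum, \<open>T4\<close> a minimum, \<open>T8\<close> a minimum above a
  maximum, and \<open>T1, T3, T5, T6, T7\<close> are strands running down.  In a crossing the horizontal strand
  runs from upper left to lower right; it is the overstrand in \<open>T9\<close> and the understrand in \<open>T10\<close>.
\<close>

fun tile_events :: "tile \<Rightarrow> event list" where
  "tile_events T2 = [Birth]"
| "tile_events T4 = [Death]"
| "tile_events T8 = [Death, Birth]"
| "tile_events T9 = [Cross True]"
| "tile_events T10 = [Cross False]"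
| "tile_events _ = []"

text \<open>
  Tiles are passed row by row, from left to right.  On reaching tile \<open>(i, j)\<close>, the strands met by
  the boundary of the part already passed are, in order, those through the bottom sides of
  \<open>(i, 0), \<dots>, (i, j - 1)\<close>, the left side of \<open>(i, j)\<close> and the top sides of \<open>(i, j), \<dots>, (i, n - 1)\<close>.
\<close>

definition strands_before :: "tiling \<Rightarrow> nat \<Rightarrow> nat \<Rightarrow> nat" where
  "strands_before M i j = card {j'. j' < j \<and> Bottom \<in> conn (M i j')}"

definition mosaic_diagram :: "nat \<Rightarrow> tiling \<Rightarrow> diagram" where
  "mosaic_diagram n M =
     concat (map (\<lambda>i. concat (map (\<lambda>j.
       map (\<lambda>a. (a, strands_before M i j)) (tile_events (M i j))) [0..<n])) [0..<n])"

definition represents :: "nat \<Rightarrow> tiling \<Rightarrow> link \<Rightarrow> bool" where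
  "represents n M K \<longleftrightarrow> mosaic n M \<and> mosaic_diagram n M \<in> K"

definition mosaic_number :: "link \<Rightarrow> nat" where
  "mosaic_number K = (LEAST n. \<exists>M. represents n M K)"

definition mosaic_tile_number :: "nat \<Rightarrow> tiling \<Rightarrow> nat" where
  "mosaic_tile_number n M = card {(i, j). i < n \<and> j < n \<and> M i j \<noteq> T0}"

definition tile_number :: "link \<Rightarrow> nat" where
  "tile_number K = (LEAST t. \<exists>n M. represents n M K \<and> mosaic_tile_number n M = t)"

definition minimal_mosaic_tile_number :: "link \<Rightarrow> nat" where
  "minimal_mosaic_tile_number K =
     (LEAST t. \<exists>M. represents (mosaic_number K) M K \<and> mosaic_tile_number (mosaic_number K) M = t)"

end

theory Submission
  imports Defs "HOL-Library.Numeral_Type"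
begin

text \<open>
  The lower bound combines an invariant of links with a count of cells.

  Colour the strands of a diagram with elements of a commutative ring so that, at every crossing,
  an understrand coloured \<open>x\<close> that passes below a strand coloured \<open>y\<close> continues with the colour
  \<open>2 * y - x\<close> (Fox colourings).  Every local move carries colourings to colourings, and it does so
  compatibly with the reduction from \<open>\<int>\<close> to \<open>\<int>/k\<close>.  Hence it is a property of the link whether
  all colourings over \<open>\<int>/k\<close> are reductions of integer colourings
  (\<open>colourings_lift_link_of\<close>).  The closure of the 2-braid with \<open>k\<close> equal crossings fails this test:
  the two caps at its top may be coloured \<open>1\<close> and \<open>0\<close> over \<open>\<int>/k\<close>, while over \<open>\<int>\<close> they have to agree
  (\<open>colourings_of_closed_2_braid_do_not_lift\<close>).  The Hopf link, the trefoil knot and Solomon's knot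
  are the cases \<open>k = 2, 3, 4\<close>.

  Call a crossing mixed if the two strands that meet there have different colours.  A colouring
  without mixed crossings lifts: replace every residue by a representative.  Nor can there be exactly
  one mixed crossing: the strands with the colour of its overstrand would then form closed curves
  in the plane that cross the remaining strands exactly once, against parity
  (\<open>mixed_not_single\<close>).  So every mosaic of one of the three links has a colouring with two mixed
  crossing tiles.  At a mixed crossing, ends on adjacent sides of the tile have different colours;
  in particular they are not joined by a loop that just turns round a corner of the tile.
  Two tiles on which all four sides are used and that have no such loop at any corner force twelve
  non-blank tiles (\<open>twelve_cells\<close>): each has four non-blank neighbours, and the strands that leave
  these neighbours without closing up at once need further tiles.

  For the upper bound, twelve tiles suffice on the \<open>4 \<times> 4\<close> board with blank corners.  Its four inner
  tiles are crossings in alternating fashion for Solomon's knot; one or two of them become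
  double arcs for the trefoil knot and the Hopf link.  A few moves collect the crossings of these
  diagrams in one column, as in a closed 2-braid (\<open>ring_of_crossings\<close>, \<open>collect_twist\<close>).  A \<open>3 \<times> 3\<close>
  board has only nine tiles, so the mosaic number of the three links is \<open>4\<close> and the same mosaics
  realise the minimal mosaic tile number.
\<close>

section \<open>Colourings of diagrams\<close>

text \<open>
  The colours around each level of a diagram, strands entering and strands leaving.  Closed diagrams
  have no ends, so a colouring has to be recorded level by level to be compared with its lifts.
\<close>

type_synonym 'c trace = "('c list \<times> 'c list) list"

text \<open>
  Fox's rule: the overstrand keeps its colour, and the colours of the two understrands are symmetric
  about it.
\<close>

inductive colour_rule :: "event \<Rightarrow> 'c::comm_ring_1 list \<Rightarrow> 'c list \<Rightarrow> bool" where
  "colour_rule Birth [] [c, c]"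
| "colour_rule Death [c, c] []"
| "colour_rule (Cross b) [x, y] (if b then [2 * x - y, x] else [y, 2 * y - x])"

inductive_simps colour_rule_Birth: "colour_rule Birth ins outs"
inductive_simps colour_rule_Death: "colour_rule Death ins outs"
inductive_simps colour_rule_Cross: "colour_rule (Cross b) ins outs"
lemmas colour_rules = colour_rule_Birth colour_rule_Death colour_rule_Cross

lemma length_colour_rule:
  "colour_rule a ins outs \<Longrightarrow> length ins = strands_in a \<and> length outs = strands_out a"
  by (auto elim: colour_rule.cases)

primrec coloured :: "'c::comm_ring_1 list \<Rightarrow> diagram \<Rightarrow> 'c trace \<Rightarrow> 'c list \<Rightarrow> bool" where
  "coloured xs [] t ys \<longleftrightarrow> t = [] \<and> ys = xs"
| "coloured xs (e # w) t ys \<longleftrightarrow> (\<exists>u ins outs v t'. xs = u @ ins @ v \<and> length u = snd e \<and>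
     colour_rule (fst e) ins outs \<and> t = (ins, outs) # t' \<and> coloured (u @ outs @ v) w t' ys)"

lemma coloured_append:
  "coloured xs (w @ w') t zs \<longleftrightarrow>
     (\<exists>t1 t2 ys. t = t1 @ t2 \<and> coloured xs w t1 ys \<and> coloured ys w' t2 zs)"
proof (induction w arbitrary: xs t)
  case (Cons e w)
  show ?case
    unfolding append_Cons coloured.simps Cons.IH
    by safe (metis append_Cons)+
qed simp

lemma length_trace: "coloured xs w t ys \<Longrightarrow> length t = length w"
  by (induction w arbitrary: xs t) auto

lemma trace_determines_end:
  "coloured xs w t ys \<Longrightarrow> coloured xs w t ys' \<Longrightarrow> ys = ys'"
proof (induction w arbitrary: xs t)
  case (Cons e w)
  from Cons.prems show ?case
    by (auto simp: append_eq_append_conv intro: Cons.IH)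
qed simp

lemma coloured_leads: "coloured xs w t ys \<Longrightarrow> leads (length xs) w (length ys)"
proof (induction w arbitrary: xs t)
  case (Cons e w)
  obtain a p where e: "e = (a, p)" by force
  from Cons.prems obtain u ins outs v t' where *: "xs = u @ ins @ v" "length u = p"
    "colour_rule a ins outs" "coloured (u @ outs @ v) w t' ys"
    by (auto simp: e)
  show ?case using Cons.IH[OF *(4)] *(1,2) length_colour_rule[OF *(3)]
    by (simp add: e add_ac)
qed simp

lemma leads_append: "leads k (w @ w') m \<longleftrightarrow> (\<exists>l. leads k w l \<and> leads l w' m)"
  by (induction k w m rule: leads.induct) auto

lemma leads_unique: "leads k w m \<Longrightarrow> leads k w m' \<Longrightarrow> m = m'"
  by (induction k w m rule: leads.induct) auto

text \<open>
  Moves happen at an arbitrary position \<open>i\<close>; the strands to the left of it are spectators.  This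
  reduces the study of a local move to \<open>i = 0\<close>.
\<close>

abbreviation shift :: "nat \<Rightarrow> diagram \<Rightarrow> diagram" where
  "shift i \<equiv> map (\<lambda>(a, p). (a, i + p))"

lemma coloured_shift:
  "coloured (u @ xs) (shift (length u) w) t ys \<longleftrightarrow> (\<exists>ys'. ys = u @ ys' \<and> coloured xs w t ys')"
proof (induction w arbitrary: xs t)
  case (Cons e w)
  obtain a p where e: "e = (a, p)" by force
  show ?case
  proof
    assume "coloured (u @ xs) (shift (length u) (e # w)) t ys"
    then obtain u' ins outs v t' where *: "u @ xs = u' @ ins @ v" "length u' = length u + p"
      "colour_rule a ins outs" "t = (ins, outs) # t'"
      "coloured (u' @ outs @ v) (shift (length u) w) t' ys"
      by (auto simp: e)
    define u'' where "u'' = drop (length u) u'"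
    have u': "u' = u @ u''"
      using *(1,2) unfolding u''_def by (metis append_eq_append_conv_if append_take_drop_id le_add1)
    with * Cons.IH[of "u'' @ outs @ v" t'] show "\<exists>ys'. ys = u @ ys' \<and> coloured xs (e # w) t ys'"
      unfolding e coloured.simps by fastforce
  next
    assume "\<exists>ys'. ys = u @ ys' \<and> coloured xs (e # w) t ys'"
    then obtain ys' u' ins outs v t' where *: "ys = u @ ys'" "xs = u' @ ins @ v" "length u' = p"
      "colour_rule a ins outs" "t = (ins, outs) # t'" "coloured (u' @ outs @ v) w t' ys'"
      by (auto simp: e)
    then have "coloured (u @ u' @ outs @ v) (shift (length u) w) t' ys"
      using Cons.IH by blast
    then show "coloured (u @ xs) (shift (length u) (e # w)) t ys"
      using *(2-5) unfolding e
      by (simp, intro exI[of _ "u @ u'"] exI[of _ ins] exI[of _ outs] exI[of _ v]) simp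
  qed
qed auto

text \<open>
  The ring homomorphism from the integers preserves Fox's rule.
\<close>

abbreviation reduce :: "int trace \<Rightarrow> 'c::comm_ring_1 trace" where
  "reduce \<equiv> map (map_prod (map of_int) (map of_int))"

lemma coloured_reduce:
  "coloured xs w t ys \<Longrightarrow>
     coloured (map of_int xs) w (reduce t :: 'c::comm_ring_1 trace) (map of_int ys)"
proof (induction w arbitrary: xs t)
  case (Cons e w)
  obtain a p where e: "e = (a, p)" by force
  from Cons.prems obtain u ins outs v t' where *: "xs = u @ ins @ v" "length u = p"
    "colour_rule a ins outs" "coloured (u @ outs @ v) w t' ys" "t = (ins, outs) # t'"
    by (auto simp: e)
  have "colour_rule a (map of_int ins :: 'c list) (map of_int outs)"
    using *(3) by cases (auto simp: colour_rules)
  then show ?case using Cons.IH[OF *(4)] *(1,2,5) unfolding e coloured.simps by fastforce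
qed simp

section \<open>Colourings and local moves\<close>

text \<open>
  Inside the words of a local move no closed component is hidden, so the colours at the top and at the
  bottom determine all colours between.  Together with the agreement of the colours that two words
  admit at their ends, this turns colourings before a move into colourings after it, one to one.
\<close>

definition single_trace :: "'c::comm_ring_1 itself \<Rightarrow> diagram \<Rightarrow> bool" where
  "single_trace _ w \<longleftrightarrow>
     (\<forall>xs ys. \<forall>t t' :: 'c trace. coloured xs w t ys \<longrightarrow> coloured xs w t' ys \<longrightarrow> t = t')"

text \<open>
  The two length conditions say that both words make sense on the given strands.  They matter for
  moves that remove all levels: the empty word admits any number of strands.
\<close>

definition same_colourings :: "'c::comm_ring_1 itself \<Rightarrow> diagram \<Rightarrow> diagram \<Rightarrow> bool" where
  "same_colourings _ l r \<longleftrightarrow> (\<forall>(xs :: 'c list) ys. (\<exists>k. leads (length xs) l k) \<longrightarrow>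
     (\<exists>m. leads (length xs) r m) \<longrightarrow> (\<exists>t. coloured xs l t ys) = (\<exists>t. coloured xs r t ys))"

lemma single_trace_shift:
  assumes "single_trace TYPE('c::comm_ring_1) w"
  shows "single_trace TYPE('c) (shift i w)"
proof (cases w)
  case (Cons e w')
  show ?thesis
    unfolding single_trace_def
  proof (intro allI impI)
    fix xs ys and t t' :: "'c trace"
    assume *: "coloured xs (shift i w) t ys" "coloured xs (shift i w) t' ys"
    then have "i \<le> length xs" by (cases e) (auto simp: Cons)
    then have xs: "xs = take i xs @ drop i xs" "length (take i xs) = i" by simp_all
    obtain zs where "ys = take i xs @ zs" "coloured (drop i xs) w t zs"
      using * coloured_shift[of "take i xs" "drop i xs" w t ys] xs by metis
    moreover obtain zs' where "ys = take i xs @ zs'" "coloured (drop i xs) w t' zs'"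
      using * coloured_shift[of "take i xs" "drop i xs" w t' ys] xs by metis
    ultimately show "t = t'" using assms unfolding single_trace_def by fastforce
  qed
qed (simp add: single_trace_def)

lemma same_colourings_shift:
  assumes "same_colourings TYPE('c::comm_ring_1) l r" and "l \<noteq> []"
  shows "same_colourings TYPE('c) (shift i l) (shift i r)"
  unfolding same_colourings_def
proof (intro allI impI)
  fix xs ys :: "'c list"
  assume "\<exists>k. leads (length xs) (shift i l) k" "\<exists>m. leads (length xs) (shift i r) m"
  then obtain k m where leads: "leads (length xs) (shift i l) k" "leads (length xs) (shift i r) m"
    by blast
  obtain e l' where "l = e # l'" using assms(2) by (cases l) auto
  then have i: "i \<le> length xs" using leads(1) by (cases e) auto
  \<comment> \<open>Without the spectators the words still make sense.\<close>
  have lower: "\<exists>m'. leads (n - i) w m'" if "leads n (shift i w) m" "i \<le> n" for n w m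
    using that
  proof (induction w arbitrary: n)
    case (Cons e w)
    obtain a p where "e = (a, p)" by force
    then have e: "e = (a, p)" "i + p + strands_in a \<le> n"
      "leads (n - strands_in a + strands_out a) (shift i w) m"
      using Cons.prems by auto
    moreover have "n - strands_in a + strands_out a - i = n - i - strands_in a + strands_out a"
      using e(2) by simp
    ultimately show ?case using Cons.IH[OF e(3)] by auto
  qed auto
  define us zs where "us = take i xs" and "zs = drop i xs"
  have xs: "xs = us @ zs" "length us = i" "length zs = length xs - i"
    using i by (auto simp: us_def zs_def)
  obtain k' m' where "leads (length zs) l k'" "leads (length zs) r m'"
    using lower leads i xs(3) by metis
  then have same: "(\<exists>t. coloured zs l t ys') = (\<exists>t. coloured zs r t ys')" for ys'
    using assms(1) unfolding same_colourings_def by blast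
  have shifted: "coloured xs (shift i w) t ys \<longleftrightarrow> (\<exists>ys'. ys = us @ ys' \<and> coloured zs w t ys')" for w t
    using coloured_shift[of us zs w t ys] xs(1,2) by simp
  show "(\<exists>t. coloured xs (shift i l) t ys) = (\<exists>t. coloured xs (shift i r) t ys)"
    unfolding shifted using same by blast
qed

text \<open>
  Bookkeeping for the interchange of distant levels: the strands \<open>us\<close> between the two levels.
\<close>

lemma append_overlap:
  assumes "xs @ ys = zs @ ts" and "length xs \<le> length zs"
  obtains us where "zs = xs @ us" and "ys = us @ ts"
proof (rule that[of "drop (length xs) zs"])
  show "zs = xs @ drop (length xs) zs" "ys = drop (length xs) zs @ ts"
    using assms by (simp_all add: append_eq_append_conv_if split: if_splits)
      (metis append_take_drop_id)
qed

text \<open>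
  Two levels that involve disjoint sets of strands, \<open>n\<close> strands apart, seen at once.  The order of the
  levels does not enter, which is why they can be interchanged.
\<close>

definition side_by_side ::
  "event \<Rightarrow> nat \<Rightarrow> event \<Rightarrow> nat \<Rightarrow> 'c::comm_ring_1 list \<Rightarrow> 'c list \<Rightarrow> 'c list \<Rightarrow> 'c list \<Rightarrow> 'c list \<Rightarrow>
     'c list \<Rightarrow> bool" where
  "side_by_side a p b n xs ins outs ins' outs' ys \<longleftrightarrow> (\<exists>u m v. length u = p \<and> length m = n \<and>
     xs = u @ ins @ m @ ins' @ v \<and> ys = u @ outs @ m @ outs' @ v \<and>
     colour_rule a ins outs \<and> colour_rule b ins' outs')"

lemma side_by_side_unique:
  assumes "side_by_side a p b n xs ins outs ins' outs' ys"
    and "side_by_side a p b n xs ins2 outs2 ins2' outs2' ys"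
  shows "ins = ins2 \<and> outs = outs2 \<and> ins' = ins2' \<and> outs' = outs2'"
proof -
  obtain u m v where 1: "length u = p" "length m = n"
    "xs = u @ ins @ m @ ins' @ v" "ys = u @ outs @ m @ outs' @ v"
    "colour_rule a ins outs" "colour_rule b ins' outs'"
    using assms(1) unfolding side_by_side_def by blast
  obtain u2 m2 v2 where 2: "length u2 = p" "length m2 = n"
    "xs = u2 @ ins2 @ m2 @ ins2' @ v2" "ys = u2 @ outs2 @ m2 @ outs2' @ v2"
    "colour_rule a ins2 outs2" "colour_rule b ins2' outs2'"
    using assms(2) unfolding side_by_side_def by blast
  have "length u = length u2" "length m = length m2" "length ins = length ins2"
    "length outs = length outs2" "length ins' = length ins2'" "length outs' = length outs2'"
    using 1(1,2) 2(1,2) length_colour_rule[OF 1(5)] length_colour_rule[OF 2(5)]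
      length_colour_rule[OF 1(6)] length_colour_rule[OF 2(6)] by simp_all
  moreover have "u @ ins @ m @ ins' @ v = u2 @ ins2 @ m2 @ ins2' @ v2"
    "u @ outs @ m @ outs' @ v = u2 @ outs2 @ m2 @ outs2' @ v2"
    using 1(3,4) 2(3,4) by simp_all
  ultimately show ?thesis by simp
qed

lemma coloured_left_then_right:
  assumes "p + strands_out a \<le> q"
  shows "coloured xs [(a, p), (b, q)] t ys \<longleftrightarrow> (\<exists>ins outs ins' outs'. t = [(ins, outs), (ins', outs')] \<and>
    side_by_side a p b (q - (p + strands_out a)) xs ins outs ins' outs' ys)"
proof
  assume "coloured xs [(a, p), (b, q)] t ys"
  then obtain u ins outs v u' ins' outs' v' where *: "xs = u @ ins @ v" "length u = p"
    "colour_rule a ins outs" "u @ outs @ v = u' @ ins' @ v'" "length u' = q"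
    "colour_rule b ins' outs'" "t = [(ins, outs), (ins', outs')]" "ys = u' @ outs' @ v'"
    unfolding coloured.simps prod.sel by blast
  obtain m where m: "u' = (u @ outs) @ m" "v = m @ ins' @ v'"
    by (rule append_overlap[of "u @ outs" v u' "ins' @ v'"]) (use *(2,4,5) assms length_colour_rule[OF *(3)] in simp_all)
  have "length m = q - (p + strands_out a)"
    using m(1) *(2,5) length_colour_rule[OF *(3)] by simp
  then have side: "side_by_side a p b (q - (p + strands_out a)) xs ins outs ins' outs' ys"
    using *(1-3,6,8) m unfolding side_by_side_def by (metis append.assoc)
  show "\<exists>ins outs ins' outs'. t = [(ins, outs), (ins', outs')] \<and>
    side_by_side a p b (q - (p + strands_out a)) xs ins outs ins' outs' ys"
    using *(7) side by blast
next
  assume "\<exists>ins outs ins' outs'. t = [(ins, outs), (ins', outs')] \<and>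
    side_by_side a p b (q - (p + strands_out a)) xs ins outs ins' outs' ys"
  then obtain ins outs ins' outs' u m v where *: "t = [(ins, outs), (ins', outs')]"
    "length u = p" "length m = q - (p + strands_out a)" "xs = u @ ins @ m @ ins' @ v"
    "ys = u @ outs @ m @ outs' @ v" "colour_rule a ins outs" "colour_rule b ins' outs'"
    unfolding side_by_side_def by blast
  have "coloured (u @ outs @ m @ ins' @ v) [(b, q)] [(ins', outs')] ys"
    using * assms length_colour_rule[OF *(6)]
    by (simp, intro exI[of _ "u @ outs @ m"] exI[of _ v]) simp
  then show "coloured xs [(a, p), (b, q)] t ys"
    using *(1,2,4,6) unfolding coloured.simps(2)[of _ "(a, p)"] by auto
qed

lemma coloured_right_then_left:
  assumes "p + strands_in a \<le> q"
  shows "coloured xs [(b, q), (a, p)] t ys \<longleftrightarrow> (\<exists>ins outs ins' outs'. t = [(ins', outs'), (ins, outs)] \<and>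
    side_by_side a p b (q - (p + strands_in a)) xs ins outs ins' outs' ys)"
proof
  assume "coloured xs [(b, q), (a, p)] t ys"
  then obtain u ins outs v u' ins' outs' v' where *: "xs = u' @ ins' @ v'" "length u = p"
    "colour_rule a ins outs" "u' @ outs' @ v' = u @ ins @ v" "length u' = q"
    "colour_rule b ins' outs'" "t = [(ins', outs'), (ins, outs)]" "ys = u @ outs @ v"
    unfolding coloured.simps prod.sel by blast
  obtain m where m: "u' = (u @ ins) @ m" "v = m @ outs' @ v'"
    by (rule append_overlap[of "u @ ins" v u' "outs' @ v'"]) (use *(2,4,5) assms length_colour_rule[OF *(3)] in simp_all)
  have "length m = q - (p + strands_in a)"
    using m(1) *(2,5) length_colour_rule[OF *(3)] by simp
  then have side: "side_by_side a p b (q - (p + strands_in a)) xs ins outs ins' outs' ys"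
    using *(1-3,6,8) m unfolding side_by_side_def by (metis append.assoc)
  show "\<exists>ins outs ins' outs'. t = [(ins', outs'), (ins, outs)] \<and>
    side_by_side a p b (q - (p + strands_in a)) xs ins outs ins' outs' ys"
    using *(7) side by blast
next
  assume "\<exists>ins outs ins' outs'. t = [(ins', outs'), (ins, outs)] \<and>
    side_by_side a p b (q - (p + strands_in a)) xs ins outs ins' outs' ys"
  then obtain ins outs ins' outs' u m v where *: "t = [(ins', outs'), (ins, outs)]"
    "length u = p" "length m = q - (p + strands_in a)" "xs = u @ ins @ m @ ins' @ v"
    "ys = u @ outs @ m @ outs' @ v" "colour_rule a ins outs" "colour_rule b ins' outs'"
    unfolding side_by_side_def by blast
  have "coloured (u @ ins @ m @ outs' @ v) [(a, p)] [(ins, outs)] ys"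
    using * by auto
  then show "coloured xs [(b, q), (a, p)] t ys"
    using * assms length_colour_rule[OF *(6)] unfolding coloured.simps(2)[of _ "(b, q)"]
    by (intro exI[of _ "u @ ins @ m"] exI[of _ ins'] exI[of _ outs'] exI[of _ v] exI[of _ "[(ins, outs)]"]) simp
qed

lemma interchange_colourings:
  assumes "p + strands_out a \<le> q"
  defines "q' \<equiv> q + strands_in a - strands_out a"
  shows "single_trace TYPE('c::comm_ring_1) [(a, p), (b, q)]" 
    "single_trace TYPE('c) [(b, q'), (a, p)]"
    "same_colourings TYPE('c) [(a, p), (b, q)] [(b, q'), (a, p)]"
proof -
  have q': "p + strands_in a \<le> q'" "q' - (p + strands_in a) = q - (p + strands_out a)"
    using assms by auto
  note * = coloured_left_then_right[OF assms(1)] coloured_right_then_left[OF q'(1), unfolded q'(2)]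
  show "single_trace TYPE('c) [(a, p), (b, q)]" "single_trace TYPE('c) [(b, q'), (a, p)]"
    unfolding single_trace_def * by (auto dest: side_by_side_unique)
  show "same_colourings TYPE('c) [(a, p), (b, q)] [(b, q'), (a, p)]"
    unfolding same_colourings_def * by blast
qed

lemma coloured_first:
  "coloured xs ((a, 0) # w) t ys \<longleftrightarrow> (\<exists>ins outs v t'. xs = ins @ v \<and>
     colour_rule a ins outs \<and> t = (ins, outs) # t' \<and> coloured (outs @ v) w t' ys)"
  by simp

lemma coloured_second:
  "coloured xs ((a, 1) # w) t ys \<longleftrightarrow> (\<exists>x ins outs v t'. xs = x # ins @ v \<and>
     colour_rule a ins outs \<and> t = (ins, outs) # t' \<and> coloured (x # outs @ v) w t' ys)"
proof -
  have one: "length u = 1 \<longleftrightarrow> (\<exists>x. u = [x])" for u :: "'a list"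
    by (auto simp: length_Suc_conv)
  show ?thesis
    unfolding coloured.simps prod.sel one
    by (auto simp del: coloured.simps) (metis append_Cons append_Nil)
qed

text \<open>
  Symbolic execution of Fox's rule on the first strands, the engine for checking single moves.
\<close>

lemma colouring_steps:
  "coloured xs ((Birth, 0) # w) t ys \<longleftrightarrow>
     (\<exists>c t'. t = ([], [c, c]) # t' \<and> coloured (c # c # xs) w t' ys)"
  "coloured xs ((Birth, 1) # w) t ys \<longleftrightarrow>
     (\<exists>x v c t'. xs = x # v \<and> t = ([], [c, c]) # t' \<and> coloured (x # c # c # v) w t' ys)"
  "coloured xs ((Death, 0) # w) t ys \<longleftrightarrow>
     (\<exists>c v t'. xs = c # c # v \<and> t = ([c, c], []) # t' \<and> coloured v w t' ys)"
  "coloured xs ((Death, 1) # w) t ys \<longleftrightarrow>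
     (\<exists>x c v t'. xs = x # c # c # v \<and> t = ([c, c], []) # t' \<and> coloured (x # v) w t' ys)"
  "coloured xs ((Cross True, 0) # w) t ys \<longleftrightarrow> (\<exists>y z v t'. xs = y # z # v \<and>
     t = ([y, z], [2 * y - z, y]) # t' \<and> coloured ((2 * y - z) # y # v) w t' ys)"
  "coloured xs ((Cross False, 0) # w) t ys \<longleftrightarrow> (\<exists>y z v t'. xs = y # z # v \<and>
     t = ([y, z], [z, 2 * z - y]) # t' \<and> coloured (z # (2 * z - y) # v) w t' ys)"
  "coloured xs ((Cross True, 1) # w) t ys \<longleftrightarrow> (\<exists>x y z v t'. xs = x # y # z # v \<and>
     t = ([y, z], [2 * y - z, y]) # t' \<and> coloured (x # (2 * y - z) # y # v) w t' ys)"
  "coloured xs ((Cross False, 1) # w) t ys \<longleftrightarrow> (\<exists>x y z v t'. xs = x # y # z # v \<and>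
     t = ([y, z], [z, 2 * z - y]) # t' \<and> coloured (x # z # (2 * z - y) # v) w t' ys)"
  unfolding coloured_first coloured_second colour_rules by auto

lemma
  shows single_zigzag_left: "single_trace TYPE('c::comm_ring_1) [(Birth, 0), (Death, 1)]"
    and single_zigzag_right: "single_trace TYPE('c) [(Birth, 1), (Death, 0)]"
    and single_slide_max: "single_trace TYPE('c) [(Birth, 1), (Cross b, 0)]"
    and single_slide_max_moved: "single_trace TYPE('c) [(Birth, 0), (Cross b, 1)]"
    and single_slide_min: "single_trace TYPE('c) [(Cross b, 0), (Death, 1)]"
    and single_slide_min_moved: "single_trace TYPE('c) [(Cross b, 1), (Death, 0)]"
    and single_R1_max: "single_trace TYPE('c) [(Birth, 0), (Cross b, 0)]"
    and single_max: "single_trace TYPE('c) [(Birth, 0)]"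
    and single_R1_min: "single_trace TYPE('c) [(Cross b, 0), (Death, 0)]"
    and single_min: "single_trace TYPE('c) [(Death, 0)]"
    and single_R2: "single_trace TYPE('c) [(Cross b, 0), (Cross (\<not> b), 0)]"
  unfolding single_trace_def by (cases b; auto simp: colouring_steps simp del: coloured.simps(2) One_nat_def)+

lemma
  shows single_R3: "single_trace TYPE('c::comm_ring_1) [(Cross a, 0), (Cross b, 1), (Cross c, 0)]"
    and single_R3_moved: "single_trace TYPE('c) [(Cross c, 1), (Cross b, 0), (Cross a, 1)]"
  unfolding single_trace_def
  by (cases a; cases b; cases c; auto simp: colouring_steps simp del: coloured.simps(2) One_nat_def)+

lemma long_enough:
  "1 \<le> length xs \<longleftrightarrow> (\<exists>x v. xs = x # v)" "2 \<le> length xs \<longleftrightarrow> (\<exists>x y v. xs = x # y # v)"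
  "3 \<le> length xs \<longleftrightarrow> (\<exists>x y z v. xs = x # y # z # v)"
  by (auto simp: Suc_le_length_iff numeral_eq_Suc)

lemma same_zigzag_left: "same_colourings TYPE('c::comm_ring_1) [(Birth, 0), (Death, 1)] []"
  unfolding same_colourings_def
  by (auto simp: colouring_steps long_enough simp del: coloured.simps(2) One_nat_def)

lemma same_zigzag_right: "same_colourings TYPE('c::comm_ring_1) [(Birth, 1), (Death, 0)] []"
  unfolding same_colourings_def
  by (auto simp: colouring_steps long_enough simp del: coloured.simps(2) One_nat_def)

lemma same_slide_max: "same_colourings TYPE('c::comm_ring_1) [(Birth, 1), (Cross b, 0)] [(Birth, 0), (Cross (\<not> b), 1)]"
  unfolding same_colourings_def
  by (cases b; auto simp: colouring_steps long_enough simp del: coloured.simps(2) One_nat_def)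

lemma same_slide_min: "same_colourings TYPE('c::comm_ring_1) [(Cross b, 0), (Death, 1)] [(Cross (\<not> b), 1), (Death, 0)]"
  unfolding same_colourings_def
  by (cases b; auto simp: colouring_steps long_enough simp del: coloured.simps(2) One_nat_def)

lemma same_R1_max: "same_colourings TYPE('c::comm_ring_1) [(Birth, 0), (Cross b, 0)] [(Birth, 0)]"
  unfolding same_colourings_def
  by (cases b; auto simp: colouring_steps long_enough simp del: coloured.simps(2) One_nat_def)

lemma same_R1_min: "same_colourings TYPE('c::comm_ring_1) [(Cross b, 0), (Death, 0)] [(Death, 0)]"
  unfolding same_colourings_def
  by (cases b; auto simp: colouring_steps long_enough simp del: coloured.simps(2) One_nat_def)

lemma same_R2: "same_colourings TYPE('c::comm_ring_1) [(Cross b, 0), (Cross (\<not> b), 0)] []"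
  unfolding same_colourings_def
  by (cases b; auto simp: colouring_steps long_enough Suc_le_length_iff simp del: coloured.simps(2) One_nat_def)

text \<open>
  Both sides send the three incoming colours to the same three outgoing ones: reflections satisfy
  \<open>2 * z - (2 * y - x) = 2 * (2 * z - y) - (2 * z - x)\<close>.
\<close>

lemma same_R3:
  assumes "b = a \<or> b = c"
  shows "same_colourings TYPE('c::comm_ring_1) [(Cross a, 0), (Cross b, 1), (Cross c, 0)]
      [(Cross c, 1), (Cross b, 0), (Cross a, 1)]"
  unfolding same_colourings_def
proof (intro allI impI)
  fix xs ys :: "'c list"
  let ?l = "[(Cross a, 0), (Cross b, 1), (Cross c, 0)]"
  let ?r = "[(Cross c, 1), (Cross b, 0), (Cross a, 1)]"
  assume "\<exists>k. leads (length xs) ?l k"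
  then obtain x y z v where xs: "xs = x # y # z # v"
    by (auto simp: Suc_le_length_iff numeral_eq_Suc)
  show "(\<exists>t. coloured xs ?l t ys) = (\<exists>t. coloured xs ?r t ys)"
    using assms by (cases a; cases b; cases c)
      (simp_all add: colouring_steps xs del: coloured.simps(2) One_nat_def, simp_all add: algebra_simps)
qed

section \<open>Lifting colourings to the integers\<close>

lemma single_trace_Nil: "single_trace TYPE('c::comm_ring_1) []"
  by (simp add: single_trace_def)

lemma local_move_colourings:
  assumes "local_move l r"
  shows "same_colourings TYPE('c::comm_ring_1) l r" "single_trace TYPE('c) l" "single_trace TYPE('c) r"
proof -
  have "same_colourings TYPE('c) l r \<and> single_trace TYPE('c) l \<and> single_trace TYPE('c) r"
    using assms
  proof cases
    case (interchange p a q b)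
    then show ?thesis using interchange_colourings[of p a q b, where 'c='c] by simp
  next
    case (zigzag_left i)
    then show ?thesis
      using same_colourings_shift[OF same_zigzag_left, where i=i and 'c='c]
        single_trace_shift[OF single_zigzag_left, where i=i and 'c='c]
      by (simp add: single_trace_Nil)
  next
    case (zigzag_right i)
    then show ?thesis
      using same_colourings_shift[OF same_zigzag_right, where i=i and 'c='c]
        single_trace_shift[OF single_zigzag_right, where i=i and 'c='c]
      by (simp add: single_trace_Nil)
  next
    case (slide_max i b)
    then show ?thesis
      using same_colourings_shift[OF same_slide_max[where b=b], where i=i and 'c='c]
        single_trace_shift[OF single_slide_max[where b=b], where i=i and 'c='c]
        single_trace_shift[OF single_slide_max_moved[where b="\<not> b"], where i=i and 'c='c] by simp
  next
    case (slide_min b i)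
    then show ?thesis
      using same_colourings_shift[OF same_slide_min[where b=b], where i=i and 'c='c]
        single_trace_shift[OF single_slide_min[where b=b], where i=i and 'c='c]
        single_trace_shift[OF single_slide_min_moved[where b="\<not> b"], where i=i and 'c='c] by simp
  next
    case (R1_max i b)
    then show ?thesis
      using same_colourings_shift[OF same_R1_max[where b=b], where i=i and 'c='c]
        single_trace_shift[OF single_R1_max[where b=b], where i=i and 'c='c]
        single_trace_shift[OF single_max, where i=i and 'c='c] by simp
  next
    case (R1_min b i)
    then show ?thesis
      using same_colourings_shift[OF same_R1_min[where b=b], where i=i and 'c='c]
        single_trace_shift[OF single_R1_min[where b=b], where i=i and 'c='c]
        single_trace_shift[OF single_min, where i=i and 'c='c] by simp
  next
    case (R2 b i)
    then show ?thesis
      using same_colourings_shift[OF same_R2[where b=b], where i=i and 'c='c]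
        single_trace_shift[OF single_R2[where b=b], where i=i and 'c='c]
      by (simp add: single_trace_Nil)
  next
    case (R3 b a c i)
    then show ?thesis
      using same_colourings_shift[OF same_R3[of b a c], where i=i and 'c='c]
        single_trace_shift[OF single_R3[where a=a and b=b and c=c], where i=i and 'c='c]
        single_trace_shift[OF single_R3_moved[where a=a and b=b and c=c], where i=i and 'c='c] by simp
  qed
  then show "same_colourings TYPE('c) l r" "single_trace TYPE('c) l" "single_trace TYPE('c) r" by auto
qed

definition colourings_lift :: "'c::comm_ring_1 itself \<Rightarrow> diagram \<Rightarrow> bool" where
  "colourings_lift _ w \<longleftrightarrow> (\<forall>t :: 'c trace. coloured [] w t [] \<longrightarrow>
     (\<exists>T. coloured [] w T [] \<and> reduce T = t))"

text \<open>
  Given a colouring after the move, pass to one before the move, lift it, and pass back.  The lift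
  obtained reduces to the given colouring outside the place of the move by construction, and inside
  because the colours there are determined by those at the two ends.
\<close>

lemma colourings_lift_replace:
  assumes lift: "colourings_lift TYPE('c::comm_ring_1) (u @ l @ v)"
    and diagrams: "link_diagram (u @ l @ v)" "link_diagram (u @ r @ v)"
    and same: "same_colourings TYPE('c) l r" "same_colourings TYPE(int) l r"
    and single: "single_trace TYPE('c) r"
  shows "colourings_lift TYPE('c) (u @ r @ v)"
  unfolding colourings_lift_def
proof (intro allI impI)
  have ok: "\<exists>k. leads n l k" "\<exists>k. leads n r k" if "leads 0 u n" for n
    using diagrams leads_unique[OF that] unfolding link_diagram_def leads_append by metis+
  have same_c: "(\<exists>t. coloured xs l t ys) = (\<exists>t. coloured xs r t ys)"
      if "leads 0 u (length xs)" for xs ys :: "'c list"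
    using that same(1) ok unfolding same_colourings_def by blast
  have same_int: "(\<exists>t. coloured Xs l t Ys) = (\<exists>t. coloured Xs r t Ys)"
      if "leads 0 u (length Xs)" for Xs Ys :: "int list"
    using that same(2) ok unfolding same_colourings_def by blast
  fix t :: "'c trace" assume "coloured [] (u @ r @ v) t []"
  then obtain tu tr tv xs ys where t: "t = tu @ tr @ tv" "coloured [] u tu xs"
      "coloured xs r tr ys" "coloured ys v tv []"
    unfolding coloured_append by blast
  have "leads 0 u (length xs)" using coloured_leads[OF t(2)] by simp
  then obtain tl where tl: "coloured xs l tl ys" using same_c t(3) by blast
  then have "coloured [] (u @ l @ v) (tu @ tl @ tv) []"
    using t unfolding coloured_append by blast
  then obtain T where "coloured [] (u @ l @ v) T []" and T: "reduce T = tu @ tl @ tv"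
    using lift unfolding colourings_lift_def by blast
  then obtain Tu Tl Tv Xs Ys where T': "T = Tu @ Tl @ Tv" "coloured [] u Tu Xs"
      "coloured Xs l Tl Ys" "coloured Ys v Tv []"
    unfolding coloured_append by blast
  have parts: "reduce Tu = tu" "reduce Tl = tl" "reduce Tv = tv"
    using T length_trace[OF t(2)] length_trace[OF T'(2)] length_trace[OF tl] length_trace[OF T'(3)]
    unfolding T'(1) by simp_all
  have xs: "map of_int Xs = xs"
    using trace_determines_end[OF coloured_reduce[OF T'(2), where 'c='c, unfolded parts]] t(2) by simp
  have ys: "map of_int Ys = ys"
    using trace_determines_end[OF coloured_reduce[OF T'(3), where 'c='c, unfolded parts xs] tl] .
  obtain Tr where Tr: "coloured Xs r Tr Ys"
    using same_int[of Xs Ys] T'(3) coloured_leads[OF T'(2)] by auto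
  then have "reduce Tr = tr"
    using coloured_reduce[OF Tr, where 'c='c, unfolded xs ys] t(3) single
    unfolding single_trace_def by blast
  moreover have "coloured [] (u @ r @ v) (Tu @ Tr @ Tv) []"
    using T'(2,4) Tr unfolding coloured_append by blast
  ultimately show "\<exists>T. coloured [] (u @ r @ v) T [] \<and> reduce T = t"
    using t(1) parts by (intro exI[of _ "Tu @ Tr @ Tv"]) simp
qed

lemma same_colourings_sym: "same_colourings TYPE('c::comm_ring_1) l r \<Longrightarrow> same_colourings TYPE('c) r l"
  unfolding same_colourings_def by metis

lemma move_colourings_lift:
  "move D D' \<Longrightarrow> colourings_lift TYPE('c::comm_ring_1) D \<longleftrightarrow> colourings_lift TYPE('c) D'"
proof (induction rule: move.induct)
  case (1 l r u v)
  note c = local_move_colourings[OF 1(1), where 'c='c] local_move_colourings[OF 1(1), where 'c=int]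
  show ?case
    using colourings_lift_replace[OF _ 1(2,3) c(1,4,3)]
      colourings_lift_replace[OF _ 1(3,2) c(1)[THEN same_colourings_sym] c(4)[THEN same_colourings_sym] c(2)]
    by blast
qed

lemma colourings_lift_link_of:
  assumes "D' \<in> link_of D"
  shows "colourings_lift TYPE('c::comm_ring_1) D \<longleftrightarrow> colourings_lift TYPE('c) D'"
proof -
  have "equivclp move D D'" using assms by (simp add: link_of_def)
  then show ?thesis
    by (induction rule: equivclp_induct) (use move_colourings_lift in blast)+
qed

section \<open>Closed 2-braids\<close>

text \<open>
  A crossing of the two strands preserves the difference of their colours and translates both colours
  by this difference, downwards or upwards according to the sign of the crossing.
\<close>

lemma coloured_twists:
  fixes x y :: "'c::comm_ring_1" and b k
  defines "d \<equiv> (if b then of_nat k else - of_nat k) * (x - y)"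
  shows "(\<exists>t. coloured (x # y # v) (replicate k (Cross b, 0)) t ys) \<longleftrightarrow> ys = (x + d) # (y + d) # v"
  unfolding d_def
proof (induction k arbitrary: x y)
  case (Suc k)
  have "(\<exists>t. coloured (x # y # v) (replicate (Suc k) (Cross b, 0)) t ys) \<longleftrightarrow>
    (\<exists>t. coloured ((if b then 2 * x - y else y) # (if b then x else 2 * y - x) # v) (replicate k (Cross b, 0)) t ys)"
    by (cases b) (simp_all add: colouring_steps del: coloured.simps(2))
  also have "\<dots> \<longleftrightarrow> ys = (x + (if b then of_nat (Suc k) else - of_nat (Suc k)) * (x - y)) #
      (y + (if b then of_nat (Suc k) else - of_nat (Suc k)) * (x - y)) # v"
    unfolding Suc.IH by (cases b) (simp_all add: algebra_simps)
  finally show ?case .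
qed auto

text \<open>
  Closing the braid identifies each colour with its translate by \<open>k\<close> times the difference.
\<close>

lemma coloured_closed_2_braid:
  "(\<exists>t. coloured [] (closed_2_braid b k) (([], [c, c]) # ([], [d, d]) # t) []) \<longleftrightarrow>
     of_nat k * (c - d :: 'c::comm_ring_1) = 0"
proof -
  let ?e = "(if b then of_nat k else - of_nat k) * (c - d)"
  have "coloured [] (closed_2_braid b k) (([], [c, c]) # ([], [d, d]) # t) [] \<longleftrightarrow>
     coloured [c, d, d, c] (replicate k (Cross b, 0) @ [(Death, 1), (Death, 0)]) t []" for t
    unfolding closed_2_braid_def append_Cons append_Nil colouring_steps by auto
  then have "(\<exists>t. coloured [] (closed_2_braid b k) (([], [c, c]) # ([], [d, d]) # t) []) \<longleftrightarrow>
      (\<exists>ys. (\<exists>t. coloured [c, d, d, c] (replicate k (Cross b, 0)) t ys) \<and>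
        (\<exists>t. coloured ys [(Death, 1), (Death, 0)] t []))"
    unfolding coloured_append by blast
  also have "\<dots> \<longleftrightarrow> (\<exists>t. coloured [c + ?e, d + ?e, d, c] [(Death, 1), (Death, 0)] t [])"
    unfolding coloured_twists by blast
  also have "\<dots> \<longleftrightarrow> of_nat k * (c - d) = 0"
    by (auto simp: colouring_steps simp del: coloured.simps(2) One_nat_def)
  finally show ?thesis .
qed

text \<open>
  The colours \<open>1\<close> and \<open>0\<close> differ in the ring, but two integer colours with difference killed by \<open>k\<close>
  are equal.
\<close>

lemma colourings_of_closed_2_braid_do_not_lift:
  assumes "of_nat k = (0 :: 'c::comm_ring_1)" and "k > 0"
  shows "\<not> colourings_lift TYPE('c) (closed_2_braid b k)"
proof
  assume lift: "colourings_lift TYPE('c) (closed_2_braid b k)"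
  have "of_nat k * (1 - 0 :: 'c) = 0" using assms by simp
  from iffD2[OF coloured_closed_2_braid this, of b]
  obtain t where t: "coloured [] (closed_2_braid b k) (([], [1, 1]) # ([], [0, 0]) # t :: 'c trace) []"
    by (rule exE)
  from lift[unfolded colourings_lift_def, rule_format, OF t]
  obtain T where T: "coloured [] (closed_2_braid b k) T []" "reduce T = ([], [1, 1]) # ([], [0, 0 :: 'c]) # t"
    by (elim exE conjE)
  from T(2) obtain c c' d d' T' where T': "T = ([], [c, c']) # ([], [d, d']) # T'"
    "of_int c = (1 :: 'c)" "of_int d = (0 :: 'c)"
    by (auto simp: map_eq_Cons_conv)
  have "c' = c" "d' = d"
    using T(1) unfolding T'(1) closed_2_braid_def append_Cons append_Nil colouring_steps by blast+
  then have "of_nat k * (c - d) = 0"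
    using T(1) unfolding T'(1) by (intro iffD1[OF coloured_closed_2_braid, of b] exI[of _ T']) simp
  then have "c = d" using assms(2) by simp
  then show False using T'(2,3) by simp
qed

section \<open>Mixed crossings\<close>

text \<open>
  At a death the two entering strands have the same colour, so only crossings can be mixed.
\<close>

fun mixed :: "'c list \<times> 'c list \<Rightarrow> bool" where
  "mixed ([x, y], outs) \<longleftrightarrow> x \<noteq> y"
| "mixed _ \<longleftrightarrow> False"

text \<open>
  Where all colours at a crossing agree, Fox's rule reduces to equality of colours, which every map
  preserves, whether or not it is linear.
\<close>

lemma coloured_relabel:
  assumes "coloured xs w t ys" and "\<not> (\<exists>e\<in>set t. mixed e)"
  shows "coloured (map f xs :: 'd::comm_ring_1 list) w (map (map_prod (map f) (map f)) t) (map f ys)"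
  using assms
proof (induction w arbitrary: xs t)
  case (Cons e w)
  obtain a p where e: "e = (a, p)" by force
  from Cons.prems(1) obtain u ins outs v t' where *: "xs = u @ ins @ v" "length u = p"
    "colour_rule a ins outs" "coloured (u @ outs @ v) w t' ys" "t = (ins, outs) # t'"
    by (auto simp: e)
  have "colour_rule a (map f ins) (map f outs)"
    using *(3,5) Cons.prems(2) by cases (auto simp: colour_rules split: if_splits)
  then show ?case using Cons.IH[OF *(4)] Cons.prems(2) *(1,2,5) unfolding e coloured.simps by fastforce
qed simp

text \<open>
  The number of pairs of strands with the left one of colour \<open>a\<close> and the right one of another colour.
  Its parity changes only at mixed crossings.
\<close>

fun inversions :: "'c \<Rightarrow> 'c list \<Rightarrow> nat" where
  "inversions a [] = 0"
| "inversions a (x # xs) =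
     (if x = a then length (filter (\<lambda>y. y \<noteq> a) xs) else 0) + inversions a xs"

lemma inversions_append:
  "inversions a (xs @ ys) = inversions a xs + inversions a ys +
     length (filter (\<lambda>x. x = a) xs) * length (filter (\<lambda>y. y \<noteq> a) ys)"
  by (induction xs) (auto simp: algebra_simps)

lemma inversions_unmixed:
  assumes "colour_rule e ins outs" and "\<not> mixed (ins, outs)"
  shows "even (inversions a (u @ ins @ v)) \<longleftrightarrow> even (inversions a (u @ outs @ v))"
  using assms by cases (auto simp: inversions_append split: if_splits)

lemma inversions_coloured:
  assumes "coloured xs w t ys" and "\<not> (\<exists>e\<in>set t. mixed e)"
  shows "even (inversions a xs) \<longleftrightarrow> even (inversions a ys)"
  using assms
proof (induction w arbitrary: xs t)
  case (Cons e w)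
  then show ?case using inversions_unmixed by (fastforce simp del: inversions.simps)
qed simp

text \<open>
  Take for \<open>a\<close> the colour of the overstrand: as the reflection about \<open>a\<close> has the fixed colour \<open>a\<close> and is
  injective, both understrands have another colour.
\<close>

lemma inversions_mixed:
  assumes "colour_rule e ins outs" and "mixed (ins, outs)"
  obtains a where "even (inversions a (u @ ins @ v)) \<longleftrightarrow> odd (inversions a (u @ outs @ v))"
proof -
  from assms obtain b x y where *: "ins = [x, y]" "x \<noteq> y"
    "outs = (if b then [2 * x - y, x] else [y, 2 * y - x])"
    by cases auto
  have "2 * x - y \<noteq> x" "2 * y - x \<noteq> y" using *(2) by (auto simp: algebra_simps)
  then show ?thesis
    using * that[of x] that[of y] by (cases b) (auto simp: inversions_append)
qed

text \<open>
  The number of inversions vanishes above and below the diagram, so its parity cannot change exactly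
  once.
\<close>

lemma mixed_not_single:
  assumes "coloured [] w t []"
  shows "length (filter mixed t) \<noteq> 1"
proof
  assume "length (filter mixed t) = 1"
  then obtain e where "filter mixed t = [e]" by (auto simp: length_Suc_conv)
  then obtain t1 t2 where t: "t = t1 @ e # t2" "mixed e" "\<not> (\<exists>e\<in>set t1. mixed e)" "\<not> (\<exists>e\<in>set t2. mixed e)"
    by (auto simp: filter_eq_Cons_iff filter_empty_conv eq_commute[of "[]"])
  define k where "k = length t1"
  have k: "k < length w" using t(1) length_trace[OF assms] by (simp add: k_def)
  have "coloured [] (take k w @ (w ! k) # drop (Suc k) w) (t1 @ e # t2) []"
    using assms t(1) id_take_nth_drop[OF k] by simp
  then obtain s1 s2 ys where s: "t1 @ e # t2 = s1 @ s2" "coloured [] (take k w) s1 ys"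
     "coloured ys ((w ! k) # drop (Suc k) w) s2 []"
    unfolding coloured_append by blast
  have "length s1 = length t1" using length_trace[OF s(2)] k by (simp add: k_def)
  with s(1) have "s1 = t1" "s2 = e # t2" by auto
  with s obtain u ins outs v where *: "coloured [] (take k w) t1 (u @ ins @ v)" "e = (ins, outs)"
      "colour_rule (fst (w ! k)) ins outs" "coloured (u @ outs @ v) (drop (Suc k) w) t2 []"
    by auto
  obtain a where "even (inversions a (u @ ins @ v)) \<longleftrightarrow> odd (inversions a (u @ outs @ v))"
    using inversions_mixed *(2,3) t(2) by blast
  then show False
    using inversions_coloured[OF *(1) t(3), of a] inversions_coloured[OF *(4) t(4), of a] by simp
qed

text \<open>
  A set-theoretic section of the reduction lifts every colouring without mixed crossings.
\<close>

lemma two_mixed: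
  assumes "\<not> colourings_lift TYPE('c::comm_ring_1) w" and surj: "surj (of_int :: int \<Rightarrow> 'c::comm_ring_1)"
  obtains t :: "'c::comm_ring_1 trace" where "coloured [] w t []" "2 \<le> length (filter mixed t)"
proof -
  obtain t :: "'c trace" where t: "coloured [] w t []" "\<And>T. coloured [] w T [] \<Longrightarrow> reduce T \<noteq> t"
    using assms(1) unfolding colourings_lift_def by blast
  have "filter mixed t \<noteq> []"
  proof
    assume "filter mixed t = []"
    then have "\<not> (\<exists>e\<in>set t. mixed e)" by (auto simp: filter_empty_conv)
    note lift = coloured_relabel[OF t(1) this, of "inv (of_int :: int \<Rightarrow> 'c)"]
    have "of_int \<circ> inv (of_int :: int \<Rightarrow> 'c) = id"
      using surj by (simp add: surj_iff)
    then have "reduce (map (map_prod (map (inv (of_int :: int \<Rightarrow> 'c))) (map (inv of_int))) t) = t"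
      by (simp add: map_prod.comp map_prod.id)
    then show False using t(2)[OF lift[unfolded list.map(1)]] by contradiction
  qed
  then have "length (filter mixed t) \<noteq> 0" by simp
  then show ?thesis using that[OF t(1)] mixed_not_single[OF t(1)] by linarith
qed

section \<open>Closed curves on a grid\<close>

text \<open>
  Closed curves on the square grid, as the set of sides of cells that they pass through:
  \<open>h i j\<close> and \<open>v i j\<close> are the right and the bottom side of the cell in row \<open>i\<close> and column \<open>j\<close>.  Rows
  and columns are integers so that reflections of the grid are available.
\<close>

locale grid_curves =
  fixes h v :: "int \<Rightarrow> int \<Rightarrow> bool"
  assumes even_degree: "(h i (j - 1) = h i j) = (v (i - 1) j = v i j)"
begin

definition cell :: "int \<Rightarrow> int \<Rightarrow> bool" where
  "cell i j \<longleftrightarrow> h i (j - 1) \<or> h i j \<or> v (i - 1) j \<or> v i j"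

definition full :: "int \<Rightarrow> int \<Rightarrow> bool" where
  "full i j \<longleftrightarrow> h i (j - 1) \<and> h i j \<and> v (i - 1) j \<and> v i j"

text \<open>
  The four cells around the corner shared by \<open>(i, j)\<close> and \<open>(i + 1, j + 1)\<close> are joined in a cycle.
\<close>

definition block :: "int \<Rightarrow> int \<Rightarrow> bool" where
  "block i j \<longleftrightarrow> h i j \<and> h (i + 1) j \<and> v i j \<and> v i (j + 1)"

text \<open>
  For a full cell: none of its corners is encircled by a loop that returns directly to the cell.
  Such a loop passes through the other three cells at the corner, each of which has degree two.
\<close>

definition unkinked :: "int \<Rightarrow> int \<Rightarrow> bool" where
  "unkinked i j \<longleftrightarrow>
     (block (i - 1) (j - 1) \<longrightarrow> full (i - 1) (j - 1) \<or> full (i - 1) j \<or> full i (j - 1)) \<and>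
     (block (i - 1) j \<longrightarrow> full (i - 1) j \<or> full (i - 1) (j + 1) \<or> full i (j + 1)) \<and>
     (block i (j - 1) \<longrightarrow> full i (j - 1) \<or> full (i + 1) (j - 1) \<or> full (i + 1) j) \<and>
     (block i j \<longrightarrow> full i (j + 1) \<or> full (i + 1) j \<or> full (i + 1) (j + 1))"

definition cells :: "(int \<times> int) set" where
  "cells = {(i, j). cell i j}"

text \<open>
  A curve that enters a cell leaves it again through another side.
\<close>

lemma from_right: "h i j \<Longrightarrow> h i (j - 1) \<or> v (i - 1) j \<or> v i j"
  using even_degree[of i j] by auto

lemma from_left: "h i j \<Longrightarrow> h i (j + 1) \<or> v (i - 1) (j + 1) \<or> v i (j + 1)"
  using even_degree[of i "j + 1"] by auto

lemma from_below: "v i j \<Longrightarrow> v (i - 1) j \<or> h i (j - 1) \<or> h i j"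
  using even_degree[of i j] by auto

lemma from_above: "v i j \<Longrightarrow> v (i + 1) j \<or> h (i + 1) (j - 1) \<or> h (i + 1) j"
  using even_degree[of "i + 1" j] by auto

lemma h_cells: "h i j \<Longrightarrow> (i, j) \<in> cells \<and> (i, j + 1) \<in> cells"
  by (auto simp: cells_def cell_def)

lemma v_cells: "v i j \<Longrightarrow> (i, j) \<in> cells \<and> (i + 1, j) \<in> cells"
  by (auto simp: cells_def cell_def)

text \<open>
  A curve that leaves a region needs at least two cells outside: the one it enters and the one after.
  The position of the second is recorded by inequalities rather than by cases, so that distinctness
  from other cells is decided by linear arithmetic.
\<close>

lemma cell_beyond_left:
  assumes "h i j"
  obtains p q where "(p, q) \<in> cells" "\<bar>p - i\<bar> \<le> 1" "q \<le> j" "p = i \<Longrightarrow> q < j"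
  using from_right[OF assms] that[of i "j - 1"] that[of "i - 1" j] that[of "i + 1" j]
    h_cells[of i "j - 1"] v_cells[of "i - 1" j] v_cells[of i j] by auto

lemma cell_beyond_right:
  assumes "h i j"
  obtains p q where "(p, q) \<in> cells" "\<bar>p - i\<bar> \<le> 1" "q > j" "p = i \<Longrightarrow> q > j + 1"
  using from_left[OF assms] that[of i "j + 2"] that[of "i - 1" "j + 1"] that[of "i + 1" "j + 1"]
    h_cells[of i "j + 1"] v_cells[of "i - 1" "j + 1"] v_cells[of i "j + 1"] by auto

lemma cell_beyond_above:
  assumes "v i j"
  obtains p q where "(p, q) \<in> cells" "p \<le> i" "p = i \<Longrightarrow> q \<noteq> j"
  using from_below[OF assms] that[of "i - 1" j] that[of i "j - 1"] that[of i "j + 1"]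
    v_cells[of "i - 1" j] h_cells[of i "j - 1"] h_cells[of i j] by auto

lemma cell_beyond_below:
  assumes "v i j"
  obtains p q where "(p, q) \<in> cells" "p > i" "p = i + 1 \<Longrightarrow> q \<noteq> j"
  using from_above[OF assms] that[of "i + 2" j] that[of "i + 1" "j - 1"] that[of "i + 1" "j + 1"]
    v_cells[of "i + 1" j] h_cells[of "i + 1" "j - 1"] h_cells[of "i + 1" j] by auto

lemma full_cells:
  assumes "full i j"
  shows "(i, j) \<in> cells" "(i, j - 1) \<in> cells" "(i, j + 1) \<in> cells" "(i - 1, j) \<in> cells" "(i + 1, j) \<in> cells"
  using assms by (auto simp: cells_def cell_def full_def)

text \<open>
  Assumed for contradiction below; each contradiction comes from a list of twelve distinct cells.
\<close>

definition few :: bool where "few \<longleftrightarrow> finite cells \<and> card cells < 12"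

lemma few_list:
  assumes few and "distinct xs" and "set xs \<subseteq> cells"
  shows "length xs < 12"
proof -
  have "length xs = card (set xs)" using assms(2) by (simp add: distinct_card)
  also have "\<dots> \<le> card cells" using assms by (intro card_mono) (auto simp: few_def)
  finally show ?thesis using assms by (simp add: few_def)
qed

text \<open>
  Two neighbouring full cells have eight cells in their common neighbourhood, and the curves through
  their outer neighbours use one more cell on either side.  With the two cells of an excursion to the
  rows beyond, that makes twelve.
\<close>

lemma full_neighbours_row:
  assumes few and "full i j" and "full i (j + 1)"
  shows "\<not> v (i - 2) k" "\<not> v (i + 1) k"
proof -
  have K: "set [(i,j),(i,j+1),(i,j-1),(i,j+2),(i-1,j),(i-1,j+1),(i+1,j),(i+1,j+1)] \<subseteq> cells"
    using full_cells[OF assms(2)] full_cells[OF assms(3)] by (auto simp: algebra_simps)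
  obtain w w' where w: "(w, w') \<in> cells" "\<bar>w - i\<bar> \<le> 1" "w' \<le> j - 1" "w = i \<Longrightarrow> w' < j - 1"
    using cell_beyond_left[of i "j - 1"] assms(2) unfolding full_def by blast
  obtain e e' where e: "(e, e') \<in> cells" "\<bar>e - i\<bar> \<le> 1" "e' > j + 1" "e = i \<Longrightarrow> e' > j + 1 + 1"
    using cell_beyond_right[of i "j + 1"] assms(3) unfolding full_def by blast
  show "\<not> v (i - 2) k"
  proof
    assume a: "v (i - 2) k"
    obtain s s' where s: "(s, s') \<in> cells" "s \<le> i - 2" "s = i - 2 \<Longrightarrow> s' \<noteq> k"
      using cell_beyond_above[OF a] by blast
    have "distinct ((i - 2, k) # (s, s') # (w, w') # (e, e') # [(i,j),(i,j+1),(i,j-1),(i,j+2),(i-1,j),(i-1,j+1),(i+1,j),(i+1,j+1)])"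
      using s(2-) w(2-) e(2-) by auto
    from few_list[OF assms(1) this] show False
      using K s(1) w(1) e(1) v_cells[OF a] by (simp add: algebra_simps)
  qed
  show "\<not> v (i + 1) k"
  proof
    assume a: "v (i + 1) k"
    obtain s s' where s: "(s, s') \<in> cells" "s > i + 1" "s = i + 1 + 1 \<Longrightarrow> s' \<noteq> k"
      using cell_beyond_below[OF a] by blast
    have "distinct ((i + 2, k) # (s, s') # (w, w') # (e, e') # [(i,j),(i,j+1),(i,j-1),(i,j+2),(i-1,j),(i-1,j+1),(i+1,j),(i+1,j+1)])"
      using s(2-) w(2-) e(2-) by auto
    from few_list[OF assms(1) this] show False
      using K s(1) w(1) e(1) v_cells[OF a] by (simp add: algebra_simps)
  qed
qed

text \<open>
  The curve through the left neighbour of the left full cell must use the left side of this neighbour: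
  a turn upwards or downwards would either close up to a kink or need too many cells further left.
\<close>

lemma full_neighbours_exit_left:
  assumes few and "full i j" and "full i (j + 1)" and "unkinked i j"
  shows "h i (j - 2)"
proof (rule ccontr)
  assume n: "\<not> h i (j - 2)"
  note nv = full_neighbours_row[OF assms(1-3)]
  have K: "set [(i,j),(i,j+1),(i,j-1),(i,j+2),(i-1,j),(i-1,j+1),(i+1,j),(i+1,j+1)] \<subseteq> cells"
    using full_cells[OF assms(2)] full_cells[OF assms(3)] by (auto simp: algebra_simps)
  obtain e e' where e: "(e, e') \<in> cells" "\<bar>e - i\<bar> \<le> 1" "e' > j + 1" "e = i \<Longrightarrow> e' > j + 1 + 1"
    using cell_beyond_right[of i "j + 1"] assms(3) unfolding full_def by blast
  have x: "h i (j - 1)" "v (i - 1) j" "v i j" using assms(2) by (auto simp: full_def)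
  \<comment> \<open>After the turn, running on to the left would cost three cells.\<close>
  have side: False if a: "h k (j - 2)" "k = i - 1 \<or> k = i + 1" for k
  proof -
    obtain s s' where s: "(s, s') \<in> cells" "s' \<le> j - 2" "s = k \<Longrightarrow> s' < j - 2"
      using cell_beyond_left[OF a(1)] by metis
    have "distinct ((k, j - 1) # (k, j - 2) # (s, s') # (e, e') # [(i,j),(i,j+1),(i,j-1),(i,j+2),(i-1,j),(i-1,j+1),(i+1,j),(i+1,j+1)])"
      using s(2-) e(2-) a(2) by auto
    from few_list[OF assms(1) this] show False
      using K s(1) e(1) h_cells[OF a(1)] by (simp add: algebra_simps)
  qed
  consider "v (i - 1) (j - 1)" | "v i (j - 1)"
    using from_right[OF x(1)] n by auto
  then show False
  proof cases
    case 1
    then have "h (i - 1) (j - 1)"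
      using from_below[OF 1] nv[of "j - 1"] side[of "i - 1"] by auto
    then have "block (i - 1) (j - 1)" using x 1 by (simp add: block_def)
    then show False using assms(4) n nv by (auto simp: unkinked_def full_def)
  next
    case 2
    then have "h (i + 1) (j - 1)"
      using from_above[OF 2] nv[of "j - 1"] side[of "i + 1"] by auto
    then have "block i (j - 1)" using x 2 by (simp add: block_def)
    then show False using assms(4) n nv by (auto simp: unkinked_def full_def)
  qed
qed

text \<open>
  The crosses formed by the two full cells and their neighbours are disjoint and have ten cells; the
  curves leaving to the left of one and to the right of the other add two.
\<close>

lemma not_full_far:
  assumes few and "full i j" and "full i' j'" and "i < i'" and "j < j'" "i + 1 < i' \<or> j + 1 < j'"
  shows False
proof -
  let ?K = "[(i,j),(i,j-1),(i,j+1),(i-1,j),(i+1,j),(i',j'),(i',j'-1),(i',j'+1),(i'-1,j'),(i'+1,j')]"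
  have K: "set ?K \<subseteq> cells"
    using full_cells[OF assms(2)] full_cells[OF assms(3)] by auto
  obtain w w' where w: "(w, w') \<in> cells" "w' \<le> j - 1" "w = i \<Longrightarrow> w' < j - 1"
    using cell_beyond_left[of i "j - 1"] assms(2) unfolding full_def by blast
  obtain e e' where e: "(e, e') \<in> cells" "e' > j'" "e = i' \<Longrightarrow> e' > j' + 1"
    using cell_beyond_right[of i' j'] assms(3) unfolding full_def by blast
  have "distinct ((w, w') # (e, e') # ?K)"
    using w(2-) e(2-) assms(4-) by auto
  from few_list[OF assms(1) this] show False
    using K w(1) e(1) by simp
qed

text \<open>
  At distance more than two the two crosses are disjoint, and the curves leaving to the left and to the
  right add two cells.  At distance two the crosses share a cell, but then the curves through the upper
  and the lower neighbour of the left full cell both need a cell to the left.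
\<close>

lemma not_full_far_row:
  assumes few and "full i j" and "full i j'" and "j + 1 < j'"
  shows False
proof -
  obtain w w' where w: "(w, w') \<in> cells" "w' \<le> j - 1" "w = i \<Longrightarrow> w' < j - 1"
    using cell_beyond_left[of i "j - 1"] assms(2) unfolding full_def by blast
  obtain e e' where e: "(e, e') \<in> cells" "\<bar>e - i\<bar> \<le> 1" "e' > j'" "e = i \<Longrightarrow> e' > j' + 1"
    using cell_beyond_right[of i j'] assms(3) unfolding full_def by blast
  show False
  proof (cases "j' = j + 2")
    case True
    let ?K = "[(i,j),(i,j-1),(i,j+1),(i-1,j),(i+1,j),(i,j'),(i,j'+1),(i-1,j'),(i+1,j')]"
    have K: "set ?K \<subseteq> cells"
      using full_cells[OF assms(2)] full_cells[OF assms(3)] by auto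
    have n: "(p, q) \<notin> cells" if "(p, q) \<notin> set ?K" "p = i \<Longrightarrow> q < j' + 2" "q < j'" "q > j - 1" for p q
    proof
      assume c: "(p, q) \<in> cells"
      have "distinct ((p, q) # (w, w') # (e, e') # ?K)"
        using that w(2-) e(2-) True by auto
      from few_list[OF assms(1) this] show False
        using K c w(1) e(1) by simp
    qed
    have "h (i - 1) (j - 1)"
      using from_below[of "i - 1" j] n[of "i - 2" j] n[of "i - 1" "j + 1"] assms(2) True
        v_cells[of "i - 2" j] h_cells[of "i - 1" j] by (auto simp: full_def)
    moreover have "h (i + 1) (j - 1)"
      using from_above[of i j] n[of "i + 2" j] n[of "i + 1" "j + 1"] assms(2) True
        v_cells[of "i + 1" j] h_cells[of "i + 1" j] by (auto simp: full_def algebra_simps)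
    moreover have "distinct ((i - 1, j - 1) # (i + 1, j - 1) # (e, e') # ?K)"
      using e(2-) True by auto
    ultimately show False
      using few_list[OF assms(1), of "(i - 1, j - 1) # (i + 1, j - 1) # (e, e') # ?K"]
        K e(1) h_cells[of "i - 1" "j - 1"] h_cells[of "i + 1" "j - 1"] by simp
  next
    case False
    let ?K = "[(i,j),(i,j-1),(i,j+1),(i-1,j),(i+1,j),(i,j'),(i,j'-1),(i,j'+1),(i-1,j'),(i+1,j')]"
    have K: "set ?K \<subseteq> cells"
      using full_cells[OF assms(2)] full_cells[OF assms(3)] by auto
    have "distinct ((w, w') # (e, e') # ?K)"
      using w(2-) e(2-) assms(4) False by auto
    from few_list[OF assms(1) this] show False
      using K w(1) e(1) by simp
  qed
qed

text \<open>
  The curves through the upper and the left neighbour of an unkinked full cell do not merely meet in the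
  cell at the corner, so two further cells are used.  All of these lie on or above the antidiagonal through the
  full cell.
\<close>

lemma unkinked_corner:
  assumes "full i j" and "unkinked i j"
  obtains p q p' q' where "(p, q) \<in> cells" "(p', q') \<in> cells" "(p, q) \<noteq> (p', q')"
    "p + q \<le> i + j" "p' + q' \<le> i + j"
    "(p, q) \<notin> {(i, j), (i - 1, j), (i, j - 1)}" "(p', q') \<notin> {(i, j), (i - 1, j), (i, j - 1)}"
proof (cases "block (i - 1) (j - 1)")
  case True
  then have b: "(i - 1, j - 1) \<in> cells" using h_cells[of "i - 1" "j - 1"] by (simp add: block_def)
  have "full (i - 1) (j - 1) \<or> full (i - 1) j \<or> full i (j - 1)"
    using True assms(2) by (simp add: unkinked_def)
  then have "(i - 2, j - 1) \<in> cells \<or> (i - 2, j) \<in> cells \<or> (i, j - 2) \<in> cells"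
    using full_cells(4)[of "i - 1" "j - 1"] full_cells(4)[of "i - 1" j] full_cells(2)[of i "j - 1"] by auto
  then show ?thesis
    using b that[of "i - 1" "j - 1" "i - 2" "j - 1"] that[of "i - 1" "j - 1" "i - 2" j]
      that[of "i - 1" "j - 1" i "j - 2"] by auto
next
  case False
  have e: "h i (j - 1)" "v (i - 1) j" using assms(1) by (auto simp: full_def)
  have n: "v (i - 2) j \<or> h (i - 1) (j - 1) \<or> h (i - 1) j" using from_below[OF e(2)] by simp
  have w: "h i (j - 2) \<or> v (i - 1) (j - 1) \<or> v i (j - 1)" using from_right[OF e(1)] by simp
  have N: "(i - 2, j) \<in> cells \<or> (i - 1, j + 1) \<in> cells \<or> h (i - 1) (j - 1) \<and> (i - 1, j - 1) \<in> cells"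
    using n v_cells[of "i - 2" j] h_cells[of "i - 1" "j - 1"] h_cells[of "i - 1" j] by auto
  have W: "(i, j - 2) \<in> cells \<or> (i + 1, j - 1) \<in> cells \<or> v (i - 1) (j - 1) \<and> (i - 1, j - 1) \<in> cells"
    using w h_cells[of i "j - 2"] v_cells[of "i - 1" "j - 1"] v_cells[of i "j - 1"] by auto
  have "\<not> (h (i - 1) (j - 1) \<and> v (i - 1) (j - 1))" using False e by (simp add: block_def)
  with N W have "\<exists>x\<in>{(i - 2, j), (i - 1, j + 1), (i - 1, j - 1)}.
      \<exists>y\<in>{(i, j - 2), (i + 1, j - 1), (i - 1, j - 1)}. x \<in> cells \<and> y \<in> cells \<and> x \<noteq> y"
    by auto
  then obtain p q p' q' where *: "(p, q) \<in> {(i - 2, j), (i - 1, j + 1), (i - 1, j - 1)}"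
      "(p', q') \<in> {(i, j - 2), (i + 1, j - 1), (i - 1, j - 1)}"
      "(p, q) \<in> cells" "(p', q') \<in> cells" "(p, q) \<noteq> (p', q')"
    by blast
  show ?thesis by (rule that[OF *(3-5)]) (use *(1,2) in auto)
qed

text \<open>
  Symmetries of the grid reduce the relative position of two full cells to two cases, in one row or
  descending to the right.
\<close>

lemma mirrored: "grid_curves (\<lambda>i j. h i (- j - 1)) (\<lambda>i j. v i (- j))"
proof
  fix i j show "(h i (- (j - 1) - 1) = h i (- j - 1)) = (v (i - 1) (- j) = v i (- j))"
    using even_degree[of i "- j"] by auto
qed

lemma transposed: "grid_curves (\<lambda>i j. v j i) (\<lambda>i j. h j i)"
  proof
  fix i j show "(v (j - 1) i = v j i) = (h j (i - 1) = h j i)"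
    using even_degree[of j i] by auto
qed

lemma rotated: "grid_curves (\<lambda>i j. h (- i) (- j - 1)) (\<lambda>i j. v (- i - 1) (- j))"
proof
  fix i j
  show "(h (- i) (- (j - 1) - 1) = h (- i) (- j - 1)) = (v (- (i - 1) - 1) (- j) = v (- i - 1) (- j))"
    using even_degree[of "- i" "- j"] by auto
qed

interpretation rot: grid_curves "\<lambda>i j. h (- i) (- j - 1)" "\<lambda>i j. v (- i - 1) (- j)"
  by (rule rotated)

lemma rotated_full: "rot.full i j = full (- i) (- j)"
  by (auto simp: rot.full_def full_def)

lemma rotated_unkinked: "rot.unkinked i j = unkinked (- i) (- j)"
proof -
  have "rot.block i j = block (- i - 1) (- j - 1)" for i j
    by (auto simp: rot.block_def block_def)
  moreover have "- 1 - x = - x - 1" for x :: int by simp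
  ultimately show ?thesis
    unfolding rot.unkinked_def unkinked_def rotated_full by simp argo
qed

lemma rotated_cells: "rot.cells = (\<lambda>(i, j). (- i, - j)) ` cells"
proof -
  have "rot.cell i j = cell (- i) (- j)" for i j by (auto simp: rot.cell_def cell_def)
  then show ?thesis by (force simp: rot.cells_def cells_def image_iff)
qed

lemma rotated_few: "rot.few = few"
proof -
  have "inj_on (\<lambda>(i, j). (- i, - j)) cells" by (auto simp: inj_on_def)
  then show ?thesis by (simp add: rot.few_def few_def rotated_cells card_image finite_image_iff)
qed

text \<open>
  The horizontal strand leaves the common neighbourhood on both sides, which costs two cells each.
\<close>

lemma not_unkinked_row_neighbours:
  assumes few and "full i j" and "full i (j + 1)" and "unkinked i j" and "unkinked i (j + 1)"
  shows False
proof -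
  let ?K = "[(i,j),(i,j+1),(i,j-1),(i,j+2),(i-1,j),(i-1,j+1),(i+1,j),(i+1,j+1)]"
  have K: "set ?K \<subseteq> cells"
    using full_cells[OF assms(2)] full_cells[OF assms(3)] by (auto simp: algebra_simps)
  have l: "h i (j - 2)" using full_neighbours_exit_left assms by blast
  have r: "h i (j + 2)"
    using rot.full_neighbours_exit_left[of "- i" "- (j + 1)"] assms
    by (simp add: rotated_few rotated_full rotated_unkinked algebra_simps)
  obtain w w' where w: "(w, w') \<in> cells" "w' \<le> j - 2" "w = i \<Longrightarrow> w' < j - 2"
    using cell_beyond_left[OF l] by metis
  obtain e e' where e: "(e, e') \<in> cells" "e' > j + 2" "e = i \<Longrightarrow> e' > j + 2 + 1"
    using cell_beyond_right[OF r] by metis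
  have "distinct ((i, j - 2) # (i, j + 3) # (w, w') # (e, e') # ?K)"
    using w(2-) e(2-) by auto
  from few_list[OF assms(1) this] show False
    using K w(1) e(1) h_cells[OF l] h_cells[OF r] by (simp add: algebra_simps)
qed

text \<open>
  The two crosses have eight cells.  Two more lie on or above the antidiagonal through the first full
  cell and, by rotation, two on or below the antidiagonal through the second.  These antidiagonals are
  two apart, so everything is distinct.
\<close>

lemma not_unkinked_diagonal_neighbours:
  assumes few and "full i j" and "full (i + 1) (j + 1)"
    and "unkinked i j" and "unkinked (i + 1) (j + 1)"
  shows False
proof -
  obtain p q p' q' where a: "(p, q) \<in> cells" "(p', q') \<in> cells" "(p, q) \<noteq> (p', q')"
    "p + q \<le> i + j" "p' + q' \<le> i + j"
    "(p, q) \<notin> {(i, j), (i - 1, j), (i, j - 1)}" "(p', q') \<notin> {(i, j), (i - 1, j), (i, j - 1)}"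
    using unkinked_corner assms by blast
  have "rot.full (- (i + 1)) (- (j + 1))" "rot.unkinked (- (i + 1)) (- (j + 1))"
    using assms by (simp_all add: rotated_full rotated_unkinked algebra_simps)
  note corner = rot.unkinked_corner[OF this]
  obtain r s r' s' where b: "(r, s) \<in> rot.cells" "(r', s') \<in> rot.cells" "(r, s) \<noteq> (r', s')"
    "r + s \<le> - (i + 1) + - (j + 1)" "r' + s' \<le> - (i + 1) + - (j + 1)"
    "(r, s) \<notin> {(- (i + 1), - (j + 1)), (- (i + 1) - 1, - (j + 1)), (- (i + 1), - (j + 1) - 1)}"
    "(r', s') \<notin> {(- (i + 1), - (j + 1)), (- (i + 1) - 1, - (j + 1)), (- (i + 1), - (j + 1) - 1)}"
    by (rule corner)
  let ?A = "[(p, q), (p', q'), (i, j), (i - 1, j), (i, j - 1)]"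
  let ?B = "[(- r, - s), (- r', - s'), (i + 1, j + 1), (i + 2, j + 1), (i + 1, j + 2)]"
  have "(- x, - y) \<in> cells" if "(x, y) \<in> rot.cells" for x y
    using that by (auto simp: rotated_cells)
  from this[OF b(1)] this[OF b(2)] a(1,2)
  have cells: "set (?A @ [(i, j + 1), (i + 1, j)] @ ?B) \<subseteq> cells"
    using full_cells[OF assms(2)] full_cells[OF assms(3)] by (auto simp: algebra_simps)
  have A: "x + y \<le> i + j" if "(x, y) \<in> set ?A" for x y
    using that a(4,5) by auto
  have B: "x + y \<ge> i + j + 2" if "(x, y) \<in> set ?B" for x y
    using that b(4,5) by auto
  have "distinct ?A" using a(3,6,7) by simp
  moreover have "distinct ?B"
  proof -
    have "(- r, - s) \<notin> set [(i + 1, j + 1), (i + 2, j + 1), (i + 1, j + 2)]"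
      using b(6) by auto
    moreover have "(- r', - s') \<notin> set [(i + 1, j + 1), (i + 2, j + 1), (i + 1, j + 2)]"
      using b(7) by auto
    moreover have "(- r, - s) \<noteq> (- r', - s')" using b(3) by simp
    ultimately show ?thesis by simp
  qed
  moreover have "set ?A \<inter> set ([(i, j + 1), (i + 1, j)] @ ?B) = {}"
  proof -
    have M: "x + y = i + j + 1" if "(x, y) \<in> set [(i, j + 1), (i + 1, j)]" for x y
      using that by auto
    have False if "(x, y) \<in> set ?A" "(x, y) \<in> set ([(i, j + 1), (i + 1, j)] @ ?B)" for x y
      using that(2) A[OF that(1)] B[of x y] M[of x y] unfolding set_append Un_iff by linarith
    then show ?thesis by fast
  qed
  moreover have "set [(i, j + 1), (i + 1, j)] \<inter> set ?B = {}"
    using B[of i "j + 1"] B[of "i + 1" j] by auto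
  ultimately have "distinct (?A @ [(i, j + 1), (i + 1, j)] @ ?B)"
    by (simp only: distinct_append) simp
  from few_list[OF assms(1) this cells] show False by simp
qed

lemma not_unkinked_row:
  assumes few and "full i j" and "full i j'" and "unkinked i j" and "unkinked i j'" and "j \<noteq> j'"
  shows False
proof -
  have *: False if "full i k" "full i l" "unkinked i k" "unkinked i l" "k < l" for k l
    using not_unkinked_row_neighbours[of i k] not_full_far_row[of i k l] that assms(1)
    by (cases "l = k + 1") auto
  show False using *[of j j'] *[of j' j] assms by fastforce
qed

lemma not_unkinked_descending:
  assumes few and "full i j" and "full i' j'" and "unkinked i j" and "unkinked i' j'"
    and "i < i'" and "j < j'"
  shows False
proof (cases "i + 1 < i' \<or> j + 1 < j'")
  case True
  then show ?thesis using not_full_far assms by blast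
next
  case False
  then have "i' = i + 1" "j' = j + 1" using assms by auto
  then show ?thesis using not_unkinked_diagonal_neighbours assms by blast
qed

interpretation mir: grid_curves "\<lambda>i j. h i (- j - 1)" "\<lambda>i j. v i (- j)"
  by (rule mirrored)

interpretation tra: grid_curves "\<lambda>i j. v j i" "\<lambda>i j. h j i"
  by (rule transposed)

lemma mirrored_full: "mir.full i j = full i (- j)"
  by (auto simp: mir.full_def full_def)

lemma mirrored_unkinked: "mir.unkinked i j = unkinked i (- j)"
proof -
  have "mir.block i j = block i (- j - 1)" for i j
    by (auto simp: mir.block_def block_def)
  moreover have "- 1 - x = - x - 1" for x :: int by simp
  ultimately show ?thesis
    unfolding mir.unkinked_def unkinked_def mirrored_full by simp argo
qed

lemma mirrored_few: "mir.few = few"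
proof -
  have "mir.cell i j = cell i (- j)" for i j by (auto simp: mir.cell_def cell_def)
  then have "mir.cells = (\<lambda>(i, j). (i, - j)) ` cells"
    by (force simp: mir.cells_def cells_def image_iff)
  moreover have "inj_on (\<lambda>(i, j). (i, - j)) cells" by (auto simp: inj_on_def)
  ultimately show ?thesis by (simp add: mir.few_def few_def card_image finite_image_iff)
qed

lemma transposed_full: "tra.full i j = full j i"
  by (auto simp: tra.full_def full_def)

lemma transposed_unkinked: "tra.unkinked i j = unkinked j i"
proof -
  have block: "tra.block i j = block j i" for i j
    by (auto simp: tra.block_def block_def)
  show ?thesis
    unfolding tra.unkinked_def unkinked_def transposed_full block by argo
qed

lemma transposed_few: "tra.few = few"
proof -
  have "tra.cell i j = cell j i" for i j by (auto simp: tra.cell_def cell_def)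
  then have "tra.cells = prod.swap ` cells"
    by (force simp: tra.cells_def cells_def image_iff)
  then show ?thesis by (simp add: tra.few_def few_def card_image finite_image_iff)
qed

theorem twelve_cells:
  assumes "finite cells" and "full i j" and "full i' j'"
    and "unkinked i j" and "unkinked i' j'" and "(i, j) \<noteq> (i', j')"
  shows "12 \<le> card cells"
proof (rule ccontr)
  assume "\<not> 12 \<le> card cells"
  then have few using assms(1) by (simp add: few_def)
  have desc: False if "full k l" "full k' l'" "unkinked k l" "unkinked k' l'" "k < k'" for k l k' l'
  proof -
    consider "l < l'" | "l = l'" | "l' < l" by linarith
    then show False
    proof cases
      case 1
      then show ?thesis using not_unkinked_descending that \<open>few\<close> by blast
    next
      case 2
      then show ?thesis using tra.not_unkinked_row[of l k k'] that \<open>few\<close>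
        by (simp add: transposed_full transposed_unkinked transposed_few)
    next
      case 3
      then show ?thesis using mir.not_unkinked_descending[of k "- l" k' "- l'"] that \<open>few\<close>
        by (simp add: mirrored_full mirrored_unkinked mirrored_few)
    qed
  qed
  show False
    using desc[of i j i' j'] desc[of i' j' i j] not_unkinked_row[of i j j'] assms \<open>few\<close>
    by (metis linorder_neqE)
qed

end

section \<open>Colourings of mosaics\<close>

text \<open>
  The contribution of one side of a tile to the list of strands met by the scanning front.
\<close>

abbreviation strand :: "bool \<Rightarrow> 'c \<Rightarrow> 'c list" where
  "strand P c \<equiv> (if P then [c] else [])"

text \<open>
  Colours of the left, top, bottom and right side of a tile, in this order.  The colour of a side that
  is no connection point is arbitrary.
\<close>

fun tile_rule :: "tile \<Rightarrow> 'c::comm_ring_1 \<Rightarrow> 'c \<Rightarrow> 'c \<Rightarrow> 'c \<Rightarrow> bool" where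
  "tile_rule T0 l tp b r \<longleftrightarrow> True"
| "tile_rule T1 l tp b r \<longleftrightarrow> l = b"
| "tile_rule T2 l tp b r \<longleftrightarrow> b = r"
| "tile_rule T3 l tp b r \<longleftrightarrow> tp = r"
| "tile_rule T4 l tp b r \<longleftrightarrow> l = tp"
| "tile_rule T5 l tp b r \<longleftrightarrow> l = r"
| "tile_rule T6 l tp b r \<longleftrightarrow> tp = b"
| "tile_rule T7 l tp b r \<longleftrightarrow> l = b \<and> tp = r"
| "tile_rule T8 l tp b r \<longleftrightarrow> l = tp \<and> b = r"
| "tile_rule T9 l tp b r \<longleftrightarrow> r = l \<and> b = 2 * l - tp"
| "tile_rule T10 l tp b r \<longleftrightarrow> b = tp \<and> r = 2 * tp - l"

text \<open>
  On a crossing tile the strands from the left and from the top are the two that cross.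
\<close>

definition clash :: "tile \<Rightarrow> 'c \<Rightarrow> 'c \<Rightarrow> bool" where
  "clash T l tp \<longleftrightarrow> T \<in> {T9, T10} \<and> l \<noteq> tp"

lemma coloured_tile:
  assumes "coloured (u @ strand (Left \<in> conn T) l @ strand (Top \<in> conn T) tp @ v)
    (map (\<lambda>a. (a, length u)) (tile_events T)) t zs"
  obtains b r where "zs = u @ strand (Bottom \<in> conn T) b @ strand (Right \<in> conn T) r @ v"
    "tile_rule T l tp b r" "length (filter mixed t) = (if clash T l tp then 1 else 0)"
proof -
  have eq: "map (\<lambda>a. (a, length u)) (tile_events T) = shift (length u) (map (\<lambda>a. (a, 0)) (tile_events T))"
    by simp
  from assms[unfolded eq coloured_shift] obtain ys where ys: "zs = u @ ys"
      "coloured (strand (Left \<in> conn T) l @ strand (Top \<in> conn T) tp @ v) (map (\<lambda>a. (a, 0)) (tile_events T)) t ys"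
    by blast
  have "\<exists>b r. ys = strand (Bottom \<in> conn T) b @ strand (Right \<in> conn T) r @ v \<and>
      tile_rule T l tp b r \<and> length (filter mixed t) = (if clash T l tp then 1 else 0)"
    using ys(2) by (cases T) (auto simp: colouring_steps clash_def simp del: coloured.simps(2))
  then show ?thesis using that ys(1) by blast
qed

definition row_word :: "(nat \<Rightarrow> tile) \<Rightarrow> nat \<Rightarrow> diagram" where
  "row_word R n = concat (map (\<lambda>j. map (\<lambda>a. (a, card {j'. j' < j \<and> Bottom \<in> conn (R j')}))
     (tile_events (R j))) [0..<n])"

definition ends :: "side \<Rightarrow> (nat \<Rightarrow> tile) \<Rightarrow> (nat \<Rightarrow> 'c) \<Rightarrow> nat list \<Rightarrow> 'c list" where
  "ends s R c js = concat (map (\<lambda>j. strand (s \<in> conn (R j)) (c j)) js)"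

lemma length_ends: "length (ends s R c [0..<j]) = card {j'. j' < j \<and> s \<in> conn (R j')}"
proof (induction j)
  case (Suc j)
  have "{j'. j' < Suc j \<and> s \<in> conn (R j')} =
      {j'. j' < j \<and> s \<in> conn (R j')} \<union> (if s \<in> conn (R j) then {j} else {})"
    by (auto simp: less_Suc_eq)
  then show ?case using Suc by (simp add: ends_def card_insert_if)
qed (simp add: ends_def)

lemma ends_cong: "(\<And>j. j \<in> set js \<Longrightarrow> c j = c' j) \<Longrightarrow> ends s R c js = ends s R c' js"
  unfolding ends_def by (intro arg_cong[where f = concat]) auto

text \<open>
  Scanning a row from left to right, the front consists of the bottom sides of the tiles already
  passed, the side between the last tile passed and the next, and the top sides of the tiles ahead.
  The colours of the sides are defined as the front reaches them.
\<close>

lemma coloured_row: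
  fixes R :: "nat \<Rightarrow> tile" and tp :: "nat \<Rightarrow> 'c::comm_ring_1"
  assumes R: "\<And>j. Suc j < n \<Longrightarrow> Right \<in> conn (R j) \<longleftrightarrow> Left \<in> conn (R (Suc j))"
      "n > 0 \<Longrightarrow> Left \<notin> conn (R 0)"
    and "j \<le> n" and "coloured (ends Top R tp [0..<n]) (row_word R j) t ys"
  shows "\<exists>b l. ys = ends Bottom R b [0..<j] @ strand (0 < j \<and> Right \<in> conn (R (j - 1))) (l j) @
        ends Top R tp [j..<n] \<and>
      (\<forall>j'<j. tile_rule (R j') (l j') (tp j') (b j') (l (Suc j'))) \<and>
      length (filter mixed t) = card {j'. j' < j \<and> clash (R j') (l j') (tp j')}"
  using assms(3,4)
proof (induction j arbitrary: t ys)
  case 0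
  then show ?case by (simp add: row_word_def ends_def)
next
  case (Suc j)
  have row_word: "row_word R (Suc j) = row_word R j @
      map (\<lambda>a. (a, card {j'. j' < j \<and> Bottom \<in> conn (R j')})) (tile_events (R j))"
    by (simp add: row_word_def)
  from Suc.prems(2)[unfolded row_word coloured_append]
  obtain t1 t2 xs where t: "t = t1 @ t2" "coloured (ends Top R tp [0..<n]) (row_word R j) t1 xs"
      "coloured xs (map (\<lambda>a. (a, card {j'. j' < j \<and> Bottom \<in> conn (R j')})) (tile_events (R j))) t2 ys"
    by blast
  obtain b l where xs: "xs = ends Bottom R b [0..<j] @
        strand (0 < j \<and> Right \<in> conn (R (j - 1))) (l j) @ ends Top R tp [j..<n]"
      and rules: "\<forall>j'<j. tile_rule (R j') (l j') (tp j') (b j') (l (Suc j'))"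
      and mixed: "length (filter mixed t1) = card {j'. j' < j \<and> clash (R j') (l j') (tp j')}"
    using Suc.IH[OF _ t(2)] Suc.prems(1) by auto
  have left: "(0 < j \<and> Right \<in> conn (R (j - 1))) = (Left \<in> conn (R j))"
    using R(1)[of "j - 1"] R(2) Suc.prems(1) by (cases j) auto
  have top: "ends Top R tp [j..<n] = strand (Top \<in> conn (R j)) (tp j) @ ends Top R tp [Suc j..<n]"
    using Suc.prems(1) by (simp add: ends_def upt_conv_Cons)
  have "coloured (ends Bottom R b [0..<j] @ strand (Left \<in> conn (R j)) (l j) @
      strand (Top \<in> conn (R j)) (tp j) @ ends Top R tp [Suc j..<n])
      (map (\<lambda>a. (a, length (ends Bottom R b [0..<j]))) (tile_events (R j))) t2 ys"
    using t(3) unfolding xs left top length_ends by simp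
  then obtain b' r where ys: "ys = ends Bottom R b [0..<j] @ strand (Bottom \<in> conn (R j)) b' @
        strand (Right \<in> conn (R j)) r @ ends Top R tp [Suc j..<n]"
      and rule: "tile_rule (R j) (l j) (tp j) b' r"
      and mixed2: "length (filter mixed t2) = (if clash (R j) (l j) (tp j) then 1 else 0)"
    by (rule coloured_tile)
  let ?b = "b(j := b')" and ?l = "l(Suc j := r)"
  have "ends Bottom R ?b [0..<j] = ends Bottom R b [0..<j]"
    by (rule ends_cong) auto
  then have "ends Bottom R ?b [0..<Suc j] = ends Bottom R b [0..<j] @ strand (Bottom \<in> conn (R j)) b'"
    by (simp add: ends_def)
  then have "ys = ends Bottom R ?b [0..<Suc j] @
      strand (0 < Suc j \<and> Right \<in> conn (R (Suc j - 1))) (?l (Suc j)) @ ends Top R tp [Suc j..<n]"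
    using ys by simp
  moreover have "\<forall>j'<Suc j. tile_rule (R j') (?l j') (tp j') (?b j') (?l (Suc j'))"
    using rules rule by (auto simp: less_Suc_eq)
  moreover have "{j'. j' < Suc j \<and> clash (R j') (?l j') (tp j')} =
      {j'. j' < j \<and> clash (R j') (l j') (tp j')} \<union> (if clash (R j) (l j) (tp j) then {j} else {})"
    by (auto simp: less_Suc_eq)
  then have "length (filter mixed t) = card {j'. j' < Suc j \<and> clash (R j') (?l j') (tp j')}"
    using mixed mixed2 t(1) by simp
  ultimately show ?case by blast
qed

lemma mosaic_diagram_rows: "mosaic_diagram n M = concat (map (\<lambda>i. row_word (M i) n) [0..<n])"
  unfolding mosaic_diagram_def row_word_def strands_before_def ..

lemma mosaicD:
  assumes "mosaic n M" "i < n" "j < n"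
  shows "Left \<in> conn (M i j) \<Longrightarrow> 0 < j \<and> Right \<in> conn (M i (j - 1))"
    "Right \<in> conn (M i j) \<Longrightarrow> Suc j < n \<and> Left \<in> conn (M i (Suc j))"
    "Top \<in> conn (M i j) \<Longrightarrow> 0 < i \<and> Bottom \<in> conn (M (i - 1) j)"
    "Bottom \<in> conn (M i j) \<Longrightarrow> Suc i < n \<and> Top \<in> conn (M (Suc i) j)"
  using assms unfolding mosaic_def suitably_connected_def by auto

lemma coloured_mosaic_rows:
  fixes t :: "'c::comm_ring_1 trace"
  assumes "mosaic n M" and "i \<le> n"
    and "coloured [] (concat (map (\<lambda>i. row_word (M i) n) [0..<i])) t ys"
  shows "\<exists>l tp. (0 < i \<longrightarrow> ys = ends Bottom (M (i - 1)) (tp i) [0..<n]) \<and> (i = 0 \<longrightarrow> ys = []) \<and>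
      (\<forall>i'<i. \<forall>j<n. tile_rule (M i' j) (l i' j) (tp i' j) (tp (Suc i') j) (l i' (Suc j))) \<and>
      length (filter mixed t) = (\<Sum>i'<i. card {j. j < n \<and> clash (M i' j) (l i' j) (tp i' j)})"
  using assms(2,3)
proof (induction i arbitrary: t ys)
  case 0
  then show ?case by simp
next
  case (Suc i)
  then have i: "i < n" by simp
  from Suc.prems(2) have "coloured [] (concat (map (\<lambda>i. row_word (M i) n) [0..<i]) @ row_word (M i) n) t ys"
    by simp
  then obtain t1 t2 xs where t: "t = t1 @ t2"
      "coloured [] (concat (map (\<lambda>i. row_word (M i) n) [0..<i])) t1 xs"
      "coloured xs (row_word (M i) n) t2 ys"
    unfolding coloured_append by blast
  obtain l tp where xs: "0 < i \<longrightarrow> xs = ends Bottom (M (i - 1)) (tp i) [0..<n]" "i = 0 \<longrightarrow> xs = []"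
      and rules: "\<forall>i'<i. \<forall>j<n. tile_rule (M i' j) (l i' j) (tp i' j) (tp (Suc i') j) (l i' (Suc j))"
      and mixed: "length (filter mixed t1) = (\<Sum>i'<i. card {j. j < n \<and> clash (M i' j) (l i' j) (tp i' j)})"
    using Suc.IH[OF _ t(2)] i by auto
  have "(Top \<in> conn (M i j)) = (0 < i \<and> Bottom \<in> conn (M (i - 1) j))" if "j < n" for j
    using mosaicD[OF assms(1) _ that, of i] mosaicD[OF assms(1) _ that, of "i - 1"] i by auto
  then have "xs = ends Top (M i) (tp i) [0..<n]"
    using xs unfolding ends_def by (cases "i = 0") (auto intro!: arg_cong[where f = concat])
  then have row: "coloured (ends Top (M i) (tp i) [0..<n]) (row_word (M i) n) t2 ys"
    using t(3) by simp
  have "Right \<in> conn (M i j) \<longleftrightarrow> Left \<in> conn (M i (Suc j))" if "Suc j < n" for j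
    using mosaicD[OF assms(1) i, of j] mosaicD[OF assms(1) i, of "Suc j"] that by auto
  moreover have "Left \<notin> conn (M i 0)" if "n > 0"
    using mosaicD(1)[OF assms(1) i, of 0] that by auto
  ultimately obtain b l' where ys: "ys = ends Bottom (M i) b [0..<n] @
        strand (0 < n \<and> Right \<in> conn (M i (n - 1))) (l' n) @ ends Top (M i) (tp i) [n..<n]"
      and rule: "\<forall>j<n. tile_rule (M i j) (l' j) (tp i j) (b j) (l' (Suc j))"
      and mixed2: "length (filter mixed t2) = card {j. j < n \<and> clash (M i j) (l' j) (tp i j)}"
    using coloured_row[OF _ _ order_refl row] by blast
  have "Right \<notin> conn (M i (n - 1))"
    using mosaicD(2)[OF assms(1) i, of "n - 1"] i by auto
  with ys have ys: "ys = ends Bottom (M i) b [0..<n]" by (simp add: ends_def)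
  let ?l = "l(i := l')" and ?tp = "tp(Suc i := b)"
  have "\<forall>i'<Suc i. \<forall>j<n. tile_rule (M i' j) (?l i' j) (?tp i' j) (?tp (Suc i') j) (?l i' (Suc j))"
    using rules rule by (auto simp: less_Suc_eq)
  moreover have "length (filter mixed t) = (\<Sum>i'<Suc i. card {j. j < n \<and> clash (M i' j) (?l i' j) (?tp i' j)})"
    using mixed mixed2 t(1) by simp
  moreover have "ys = ends Bottom (M (Suc i - 1)) (?tp (Suc i)) [0..<n]"
    using ys by simp
  ultimately show ?case by blast
qed

text \<open>
  Read on the mosaic, a colouring of the diagram colours the sides of the tiles, and its mixed
  crossings are the tiles whose strands clash.
\<close>

lemma coloured_mosaic:
  fixes t :: "'c::comm_ring_1 trace"
  assumes "mosaic n M" and "coloured [] (mosaic_diagram n M) t []"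
  obtains l tp :: "nat \<Rightarrow> nat \<Rightarrow> 'c" where
    "\<And>i j. i < n \<Longrightarrow> j < n \<Longrightarrow> tile_rule (M i j) (l i j) (tp i j) (tp (Suc i) j) (l i (Suc j))"
    "length (filter mixed t) = card {(i, j). i < n \<and> j < n \<and> clash (M i j) (l i j) (tp i j)}"
proof -
  obtain l tp :: "nat \<Rightarrow> nat \<Rightarrow> 'c" where *:
      "\<forall>i<n. \<forall>j<n. tile_rule (M i j) (l i j) (tp i j) (tp (Suc i) j) (l i (Suc j))"
      "length (filter mixed t) = (\<Sum>i<n. card {j. j < n \<and> clash (M i j) (l i j) (tp i j)})"
    using coloured_mosaic_rows[OF assms(1) order_refl assms(2)[unfolded mosaic_diagram_rows]]
    by (elim exE conjE) blast
  have "{(i, j). i < n \<and> j < n \<and> clash (M i j) (l i j) (tp i j)} =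
      (SIGMA i:{..<n}. {j. j < n \<and> clash (M i j) (l i j) (tp i j)})"
    by auto
  then have "length (filter mixed t) = card {(i, j). i < n \<and> j < n \<and> clash (M i j) (l i j) (tp i j)}"
    using *(2) by simp
  then show ?thesis using that * by blast
qed

section \<open>Mosaics with two mixed crossings\<close>

text \<open>
  Along a kink the colour is constant, because it passes only through cells that contain a single arc;
  so two ends of the full cell on adjacent sides would have equal colours.
\<close>

lemma (in grid_curves) unkinkedI:
  fixes ch cv :: "int \<Rightarrow> int \<Rightarrow> 'c"
  assumes turns: "\<And>i j. \<not> full i j \<Longrightarrow> h i (j - 1) \<Longrightarrow> v (i - 1) j \<Longrightarrow> ch i (j - 1) = cv (i - 1) j"
      "\<And>i j. \<not> full i j \<Longrightarrow> h i (j - 1) \<Longrightarrow> v i j \<Longrightarrow> ch i (j - 1) = cv i j"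
      "\<And>i j. \<not> full i j \<Longrightarrow> h i j \<Longrightarrow> v (i - 1) j \<Longrightarrow> ch i j = cv (i - 1) j"
      "\<And>i j. \<not> full i j \<Longrightarrow> h i j \<Longrightarrow> v i j \<Longrightarrow> ch i j = cv i j"
    and differ: "ch i (j - 1) \<noteq> cv (i - 1) j" "ch i j \<noteq> cv (i - 1) j" "ch i (j - 1) \<noteq> cv i j" "ch i j \<noteq> cv i j"
  shows "unkinked i j"
  unfolding unkinked_def
proof (intro conjI impI; rule ccontr)
  assume "block (i - 1) (j - 1)" "\<not> (full (i - 1) (j - 1) \<or> full (i - 1) j \<or> full i (j - 1))"
  then show False
    using turns(4)[of "i - 1" "j - 1"] turns(2)[of "i - 1" j] turns(3)[of i "j - 1"] differ(1)
    by (simp add: block_def)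
next
  assume "block (i - 1) j" "\<not> (full (i - 1) j \<or> full (i - 1) (j + 1) \<or> full i (j + 1))"
  then show False
    using turns(4)[of "i - 1" j] turns(2)[of "i - 1" "j + 1"] turns(1)[of i "j + 1"] differ(2)
    by (simp add: block_def)
next
  assume "block i (j - 1)" "\<not> (full i (j - 1) \<or> full (i + 1) (j - 1) \<or> full (i + 1) j)"
  then show False
    using turns(4)[of i "j - 1"] turns(3)[of "i + 1" "j - 1"] turns(1)[of "i + 1" j] differ(3)
    by (simp add: block_def)
next
  assume "block i j" "\<not> (full i (j + 1) \<or> full (i + 1) j \<or> full (i + 1) (j + 1))"
  then show False
    using turns(2)[of i "j + 1"] turns(3)[of "i + 1" j] turns(1)[of "i + 1" "j + 1"] differ(4)
    by (simp add: block_def)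
qed

lemma UNIV_side: "(UNIV :: side set) = {Left, Right, Top, Bottom}"
  using side.exhaust by blast

lemma tile_turns:
  assumes "tile_rule T l tp b r" and "conn T \<noteq> UNIV"
  shows "Left \<in> conn T \<Longrightarrow> Top \<in> conn T \<Longrightarrow> l = tp" "Left \<in> conn T \<Longrightarrow> Bottom \<in> conn T \<Longrightarrow> l = b"
    "Right \<in> conn T \<Longrightarrow> Top \<in> conn T \<Longrightarrow> r = tp" "Right \<in> conn T \<Longrightarrow> Bottom \<in> conn T \<Longrightarrow> r = b"
  using assms unfolding UNIV_side by (cases T; auto)+

text \<open>
  One strand is constant through the crossing, and the other differs from it on both sides by Fox's
  rule.
\<close>

lemma clash_corners:
  assumes "tile_rule T l tp b r" and "clash T l tp"
  shows "conn T = UNIV" "l \<noteq> tp" "r \<noteq> tp" "l \<noteq> b" "r \<noteq> b"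
  using assms unfolding UNIV_side clash_def by (auto simp: algebra_simps)

text \<open>
  The sides used by a mosaic form closed curves on the grid, and clashing tiles are unkinked full cells
  of it.
\<close>

lemma two_clashes_twelve_tiles:
  fixes l tp :: "nat \<Rightarrow> nat \<Rightarrow> 'c::comm_ring_1"
  assumes "mosaic n M"
    and rules: "\<And>i j. i < n \<Longrightarrow> j < n \<Longrightarrow> tile_rule (M i j) (l i j) (tp i j) (tp (Suc i) j) (l i (Suc j))"
    and clashes: "2 \<le> card {(i, j). i < n \<and> j < n \<and> clash (M i j) (l i j) (tp i j)}"
  shows "12 \<le> mosaic_tile_number n M"
proof -
  define inside where "inside i j \<longleftrightarrow> 0 \<le> i \<and> i < int n \<and> 0 \<le> j \<and> j < int n" for i j
  define T where "T i j = M (nat i) (nat j)" for i j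
  define h where "h i j \<longleftrightarrow> inside i j \<and> Right \<in> conn (T i j)" for i j
  define v where "v i j \<longleftrightarrow> inside i j \<and> Bottom \<in> conn (T i j)" for i j
  define ch where "ch i j = l (nat i) (nat (j + 1))" for i j
  define cv where "cv i j = tp (nat (i + 1)) (nat j)" for i j
  have left: "h i (j - 1) \<longleftrightarrow> Left \<in> conn (T i j)" and top: "v (i - 1) j \<longleftrightarrow> Top \<in> conn (T i j)"
    if "inside i j" for i j
  proof -
    obtain a b where ab: "i = int a" "j = int b" "a < n" "b < n"
      using \<open>inside i j\<close> by (metis inside_def int_nat_eq nat_less_iff)
    show "h i (j - 1) \<longleftrightarrow> Left \<in> conn (T i j)"
      using mosaicD(1)[OF assms(1) ab(3,4)] mosaicD(2)[OF assms(1) ab(3), of "b - 1"] ab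
      by (cases b) (auto simp: h_def inside_def T_def nat_add_distrib)
    show "v (i - 1) j \<longleftrightarrow> Top \<in> conn (T i j)"
      using mosaicD(3)[OF assms(1) ab(3,4)] mosaicD(4)[OF assms(1) _ ab(4), of "a - 1"] ab
      by (cases a) (auto simp: v_def inside_def T_def nat_add_distrib)
  qed
  have outside: "\<not> h i (j - 1)" "\<not> v (i - 1) j" "\<not> h i j" "\<not> v i j" if "\<not> inside i j" for i j
  proof -
    show "\<not> h i j" "\<not> v i j" using that by (auto simp: h_def v_def)
    show "\<not> h i (j - 1)"
    proof
      assume "h i (j - 1)"
      then have "inside i (j - 1)" "Right \<in> conn (M (nat i) (nat (j - 1)))"
        by (auto simp: h_def T_def)
      then have "inside i j"
        using mosaicD(2)[OF assms(1), of "nat i" "nat (j - 1)"] unfolding inside_def by linarith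
      then show False using that by simp
    qed
    show "\<not> v (i - 1) j"
    proof
      assume "v (i - 1) j"
      then have "inside (i - 1) j" "Bottom \<in> conn (M (nat (i - 1)) (nat j))"
        by (auto simp: v_def T_def)
      then have "inside i j"
        using mosaicD(4)[OF assms(1), of "nat (i - 1)" "nat j"] unfolding inside_def by linarith
      then show False using that by simp
    qed
  qed
  interpret grid_curves h v
  proof
    fix i j
    show "(h i (j - 1) = h i j) = (v (i - 1) j = v i j)"
    proof (cases "inside i j")
      case True
      then show ?thesis unfolding left[OF True] top[OF True] unfolding h_def v_def by (cases "T i j") auto
    qed (simp add: outside)
  qed
  have cell: "inside i j \<and> T i j \<noteq> T0" if "cell i j" for i j
  proof (cases "inside i j")
    case True
    then show ?thesis
      using that unfolding cell_def left[OF True] top[OF True] by (auto simp: h_def v_def)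
  qed (use that outside in \<open>auto simp: cell_def\<close>)
  have cells: "cells \<subseteq> (\<lambda>(i, j). (int i, int j)) ` {(i, j). i < n \<and> j < n \<and> M i j \<noteq> T0}"
  proof
    fix p assume "p \<in> cells"
    then obtain i j where p: "p = (i, j)" "inside i j" "T i j \<noteq> T0" using cell by (auto simp: cells_def)
    then have "p = (\<lambda>(i, j). (int i, int j)) (nat i, nat j)" "nat i < n" "nat j < n"
      by (auto simp: inside_def)
    then show "p \<in> (\<lambda>(i, j). (int i, int j)) ` {(i, j). i < n \<and> j < n \<and> M i j \<noteq> T0}"
      using p(3) unfolding T_def by blast
  qed
  have fin: "finite {(i, j). i < n \<and> j < n \<and> P i j}" for P
    by (rule finite_subset[of _ "{..<n} \<times> {..<n}"]) auto
  have full: "full i j \<longleftrightarrow> inside i j \<and> conn (T i j) = UNIV" for i j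
  proof (cases "inside i j")
    case True
    then have "full i j \<longleftrightarrow> Left \<in> conn (T i j) \<and> Right \<in> conn (T i j) \<and> Top \<in> conn (T i j) \<and> Bottom \<in> conn (T i j)"
      unfolding full_def left[OF True] top[OF True] by (auto simp: h_def v_def)
    then show ?thesis using True unfolding UNIV_side by (cases "T i j") auto
  qed (simp add: full_def outside)
  have rule: "tile_rule (T i j) (ch i (j - 1)) (cv (i - 1) j) (cv i j) (ch i j)" if "inside i j" for i j
    using rules[of "nat i" "nat j"] that
    by (simp add: T_def ch_def cv_def inside_def nat_add_distrib nat_less_iff)
  have turns: "h i (j - 1) \<Longrightarrow> v (i - 1) j \<Longrightarrow> ch i (j - 1) = cv (i - 1) j"
      "h i (j - 1) \<Longrightarrow> v i j \<Longrightarrow> ch i (j - 1) = cv i j"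
      "h i j \<Longrightarrow> v (i - 1) j \<Longrightarrow> ch i j = cv (i - 1) j"
      "h i j \<Longrightarrow> v i j \<Longrightarrow> ch i j = cv i j" if "\<not> full i j" for i j
  proof -
    have "conn (T i j) \<noteq> UNIV" if "inside i j" using \<open>\<not> full i j\<close> that by (simp add: full)
    note turns = tile_turns[OF rule this]
    show "h i (j - 1) \<Longrightarrow> v (i - 1) j \<Longrightarrow> ch i (j - 1) = cv (i - 1) j"
      "h i (j - 1) \<Longrightarrow> v i j \<Longrightarrow> ch i (j - 1) = cv i j"
      "h i j \<Longrightarrow> v (i - 1) j \<Longrightarrow> ch i j = cv (i - 1) j"
      "h i j \<Longrightarrow> v i j \<Longrightarrow> ch i j = cv i j"
      using turns left[of i j] top[of i j] outside[of i j] h_def[of i j] v_def[of i j] by blast+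
  qed
  have unkinked: "full (int i) (int j)" "unkinked (int i) (int j)"
    if "i < n" "j < n" "clash (M i j) (l i j) (tp i j)" for i j
  proof -
    have inside: "inside (int i) (int j)" using that by (simp add: inside_def)
    have "clash (T (int i) (int j)) (ch (int i) (int j - 1)) (cv (int i - 1) (int j))"
      using that by (simp add: T_def ch_def cv_def)
    note corners = clash_corners[OF rule[OF inside] this]
    show "full (int i) (int j)" using inside corners(1) by (simp add: full)
    show "unkinked (int i) (int j)" by (rule unkinkedI[OF turns corners(2-)])
  qed
  obtain i j i' j' where "i < n" "j < n" "clash (M i j) (l i j) (tp i j)"
      "i' < n" "j' < n" "clash (M i' j') (l i' j') (tp i' j')" "(i, j) \<noteq> (i', j')"
  proof -
    let ?S = "{(i, j). i < n \<and> j < n \<and> clash (M i j) (l i j) (tp i j)}"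
    have "\<not> card ?S \<le> Suc 0" using clashes by linarith
    then obtain x y where "x \<in> ?S" "y \<in> ?S" "x \<noteq> y"
      unfolding card_le_Suc0_iff_eq[OF fin] by blast
    then show ?thesis using that by (cases x; cases y) auto
  qed
  then have "12 \<le> card cells"
    using unkinked twelve_cells[of "int i" "int j" "int i'" "int j'"] finite_subset[OF cells] fin
    by auto
  also have "\<dots> \<le> card {(i, j). i < n \<and> j < n \<and> M i j \<noteq> T0}"
    using cells fin by (meson surj_card_le)
  finally show ?thesis by (simp add: mosaic_tile_number_def)
qed

lemma twelve_tiles:
  assumes "represents n M (link_of (closed_2_braid b k))"
    and "of_nat k = (0 :: 'c::comm_ring_1)" "k > 0" "surj (of_int :: int \<Rightarrow> 'c)"
  shows "12 \<le> mosaic_tile_number n M"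
proof -
  have M: "mosaic n M" "mosaic_diagram n M \<in> link_of (closed_2_braid b k)"
    using assms(1) by (simp_all add: represents_def)
  have "\<not> colourings_lift TYPE('c) (mosaic_diagram n M)"
    using colourings_of_closed_2_braid_do_not_lift[OF assms(2,3)] colourings_lift_link_of[OF M(2)] by blast
  from two_mixed[OF this assms(4)]
  obtain t :: "'c trace" where t: "coloured [] (mosaic_diagram n M) t []" "2 \<le> length (filter mixed t)" .
  show ?thesis
  proof (rule coloured_mosaic[OF M(1) t(1)])
    fix l tp :: "nat \<Rightarrow> nat \<Rightarrow> 'c"
    assume "\<And>i j. i < n \<Longrightarrow> j < n \<Longrightarrow> tile_rule (M i j) (l i j) (tp i j) (tp (Suc i) j) (l i (Suc j))"
      and "length (filter mixed t) = card {(i, j). i < n \<and> j < n \<and> clash (M i j) (l i j) (tp i j)}"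
    then show ?thesis
      using t(2) by (intro two_clashes_twelve_tiles[OF M(1), of l tp]) simp_all
  qed
qed

text \<open>
  The numeral types \<open>2\<close>, \<open>3\<close> and \<open>4\<close> are the rings of residues.
\<close>

lemma surj_mod: "surj (of_int :: int \<Rightarrow> 2)" "surj (of_int :: int \<Rightarrow> 3)" "surj (of_int :: int \<Rightarrow> 4)"
proof -
  show "surj (of_int :: int \<Rightarrow> 2)" unfolding surj_def by (metis bit0_cases)
  show "surj (of_int :: int \<Rightarrow> 3)" unfolding surj_def by (metis bit1_cases)
  show "surj (of_int :: int \<Rightarrow> 4)" unfolding surj_def by (metis bit0_cases)
qed

lemma twelve_tiles_links:
  "represents n M (hopf_link b) \<Longrightarrow> 12 \<le> mosaic_tile_number n M"
  "represents n M (trefoil_knot b) \<Longrightarrow> 12 \<le> mosaic_tile_number n M"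
  "represents n M (solomon_knot b) \<Longrightarrow> 12 \<le> mosaic_tile_number n M"
  unfolding hopf_link_def trefoil_knot_def solomon_knot_def
  by (erule twelve_tiles[OF _ _ _ surj_mod(1)] twelve_tiles[OF _ _ _ surj_mod(2)] twelve_tiles[OF _ _ _ surj_mod(3)]; simp)+

section \<open>Mosaics with twelve tiles\<close>

lemma equiv_local_move:
  assumes "local_move l r" and "link_diagram (u @ l @ v)" "link_diagram (u @ r @ v)"
  shows "equivclp move (u @ l @ v) (u @ r @ v)" "equivclp move (u @ r @ v) (u @ l @ v)"
proof -
  show "equivclp move (u @ l @ v) (u @ r @ v)"
    using assms by (intro r_into_equivclp) (rule move.intros)
  then show "equivclp move (u @ r @ v) (u @ l @ v)" by (rule equivclp_sym)
qed

lemma leads_crossings [simp]: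
  "leads k (replicate n (Cross b, p) @ w) m \<longleftrightarrow> (n > 0 \<longrightarrow> p + 2 \<le> k) \<and> leads k w m"
proof (cases "p + 2 \<le> k")
  case True
  then have "k - 2 + 2 = k" by simp
  with True show ?thesis by (induction n) (simp_all del: add_2_eq_Suc')
next
  case False
  then show ?thesis by (cases n) auto
qed

lemma leads_cut: "leads k u l \<Longrightarrow> leads k (u @ w) m \<longleftrightarrow> leads l w m"
  using leads_unique unfolding leads_append by blast

text \<open>
  Two caps side by side whose inner legs cross are two nested caps whose right legs cross: pull the
  leg of one cap over or under the maximum of the other.
\<close>

lemma separate_caps:
  assumes "leads 4 w 0"
  shows "equivclp move ([(Birth, 0), (Birth, 0), (Cross (\<not> b), 1)] @ w)
                       ([(Birth, 0), (Birth, 1), (Cross b, 2)] @ w)"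
proof -
  have "equivclp move ([] @ [(Birth, 0), (Birth, 0)] @ (Cross (\<not> b), 1) # w)
                      ([] @ [(Birth, 0), (Birth, 2)] @ (Cross (\<not> b), 1) # w)"
    by (rule equiv_local_move(2)) (use assms local_move.interchange[of 0 Birth 2 Birth] in
        \<open>auto simp: eval_nat_numeral link_diagram_def\<close>)
  moreover have "equivclp move ([(Birth, 0)] @ [(Birth, 2), (Cross (\<not> b), 1)] @ w)
                           ([(Birth, 0)] @ [(Birth, 1), (Cross b, 2)] @ w)"
    by (rule equiv_local_move(1)) (use assms local_move.slide_max[of 1 "\<not> b"] in
        \<open>auto simp: eval_nat_numeral link_diagram_def\<close>)
  ultimately show ?thesis 
    unfolding append_assoc append.simps replicate_Suc by (rule equivclp_trans)
qed

text \<open>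
  A crossing of the right legs of two nested caps can be moved over the top to the left legs, since
  both become the same crossing when the caps are pulled apart.
\<close>

lemma twist_nested_caps:
  assumes "leads 4 w 0"
  shows "equivclp move ([(Birth, 0), (Birth, 1), (Cross b, 2)] @ w)
                       ([(Birth, 0), (Birth, 1), (Cross b, 0)] @ w)"
proof -
  have "equivclp move ([(Birth, 0)] @ [(Birth, 0), (Cross (\<not> b), 1)] @ w)
                      ([(Birth, 0)] @ [(Birth, 1), (Cross b, 0)] @ w)"
    by (rule equiv_local_move(2)) (use assms local_move.slide_max[of 0 b] in \<open>auto simp: eval_nat_numeral link_diagram_def\<close>)
  with separate_caps[OF assms, of b, THEN equivclp_sym] show ?thesis
    
    unfolding append_assoc append.simps replicate_Suc by (rule equivclp_trans)
qed

lemma distant_crossings_commute: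
  assumes "leads 0 u 4" and "leads 4 w 0"
  shows "equivclp move (u @ replicate k (Cross b, 0) @ (Cross c, 2) # w)
                       (u @ (Cross c, 2) # replicate k (Cross b, 0) @ w)"
  using assms(1)
proof (induction k arbitrary: u)
  case (Suc k)
  have "equivclp move ((u @ [(Cross b, 0)]) @ replicate k (Cross b, 0) @ (Cross c, 2) # w)
                      ((u @ [(Cross b, 0)]) @ (Cross c, 2) # replicate k (Cross b, 0) @ w)"
    using Suc.prems by (intro Suc.IH) (simp add: leads_cut)
  moreover have "equivclp move (u @ [(Cross b, 0), (Cross c, 2)] @ replicate k (Cross b, 0) @ w)
                           (u @ [(Cross c, 2), (Cross b, 0)] @ replicate k (Cross b, 0) @ w)"
    by (rule equiv_local_move(1))
      (use Suc.prems assms(2) local_move.interchange[of 0 "Cross b" 2 "Cross c"] in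
        \<open>auto simp: eval_nat_numeral link_diagram_def leads_cut[OF Suc.prems, unfolded eval_nat_numeral]\<close>)
  ultimately show ?case 
    unfolding append_assoc append.simps replicate_Suc by (rule equivclp_trans)
qed simp

lemma collect_twist:
  assumes "leads 4 w 0"
  shows "equivclp move ([(Birth, 0), (Birth, 1)] @ replicate k (Cross b, 0) @ (Cross b, 2) # w)
                       ([(Birth, 0), (Birth, 1)] @ replicate (Suc k) (Cross b, 0) @ w)"
proof -
  have "equivclp move ([(Birth, 0), (Birth, 1)] @ replicate k (Cross b, 0) @ (Cross b, 2) # w)
                      ([(Birth, 0), (Birth, 1)] @ (Cross b, 2) # replicate k (Cross b, 0) @ w)"
    by (rule distant_crossings_commute) (use assms in \<open>simp_all add: eval_nat_numeral\<close>)
  moreover have "equivclp move ([(Birth, 0), (Birth, 1), (Cross b, 2)] @ replicate k (Cross b, 0) @ w)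
                           ([(Birth, 0), (Birth, 1), (Cross b, 0)] @ replicate k (Cross b, 0) @ w)"
    by (rule twist_nested_caps) (use assms in \<open>simp add: eval_nat_numeral\<close>)
  ultimately show ?thesis 
    unfolding append_assoc append.simps replicate_Suc by (rule equivclp_trans)
qed

text \<open>
  The counterpart of \<open>separate_caps\<close> at the lower end.
\<close>

lemma separate_cups:
  assumes "leads 0 u 4"
  shows "equivclp move (u @ [(Cross (\<not> b), 1), (Death, 2), (Death, 0)])
                       (u @ [(Cross b, 2), (Death, 1), (Death, 0)])"
proof -
  have "equivclp move (u @ [(Cross (\<not> b), 1), (Death, 2)] @ [(Death, 0)])
                      (u @ [(Cross b, 2), (Death, 1)] @ [(Death, 0)])"
    by (rule equiv_local_move(1)) (use assms local_move.slide_min[of "\<not> b" 1] in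
        \<open>auto simp: eval_nat_numeral link_diagram_def leads_cut[OF assms, unfolded eval_nat_numeral]\<close>)
  then show ?thesis by simp
qed

text \<open>
  The crossing of the inner legs of the two caps becomes one of the two left strands, that of the inner
  legs of the two cups one of the two right strands.  Both change sign on the way, which is why the
  signs have to alternate on the board.
\<close>

lemma ring_of_crossings:
  assumes "leads 4 w 4"
  shows "equivclp move
    ([(Birth, 0), (Birth, 0), (Cross (\<not> b), 1)] @ w @ [(Cross (\<not> b), 1), (Death, 2), (Death, 0)])
    ([(Birth, 0), (Birth, 1), (Cross b, 0)] @ w @ [(Cross b, 2), (Death, 1), (Death, 0)])"
proof -
  have "equivclp move
    ([(Birth, 0), (Birth, 0), (Cross (\<not> b), 1)] @ w @ [(Cross (\<not> b), 1), (Death, 2), (Death, 0)])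
    ([(Birth, 0), (Birth, 1), (Cross b, 2)] @ w @ [(Cross (\<not> b), 1), (Death, 2), (Death, 0)])"
    by (rule separate_caps) (simp add: leads_cut[OF assms])
  also have "equivclp move \<dots>
    ([(Birth, 0), (Birth, 1), (Cross b, 0)] @ w @ [(Cross (\<not> b), 1), (Death, 2), (Death, 0)])"
    by (rule twist_nested_caps) (simp add: leads_cut[OF assms])
  also have "equivclp move \<dots>
    ([(Birth, 0), (Birth, 1), (Cross b, 0)] @ w @ [(Cross b, 2), (Death, 1), (Death, 0)])"
    using separate_cups[of "[(Birth, 0), (Birth, 1), (Cross b, 0)] @ w"] assms
    by (simp add: eval_nat_numeral)
  finally show ?thesis .
qed

text \<open>
  The board of side four with blank corners, framed by single arcs.  Its inner tiles are \<open>p, q\<close> above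
  \<open>r, s\<close>.
\<close>

definition board :: "tile \<Rightarrow> tile \<Rightarrow> tile \<Rightarrow> tile \<Rightarrow> tiling" where
  "board p q r s i j = [[T0, T2, T1, T0], [T2, p, q, T1], [T3, r, s, T4], [T0, T3, T4, T0]] ! i ! j"

definition crossing_tile :: "bool \<Rightarrow> tile" where
  "crossing_tile b = (if b then T9 else T10)"

lemma tile_events_crossing [simp]: "tile_events (crossing_tile b) = [Cross b]"
  by (simp add: crossing_tile_def)

lemma conn_crossing [simp]: "conn (crossing_tile b) = UNIV"
  unfolding UNIV_side by (auto simp: crossing_tile_def)

lemma all_less_4: "(\<forall>i<4. P i) \<longleftrightarrow> P 0 \<and> P 1 \<and> P 2 \<and> P (3 :: nat)"
  by (simp add: All_less_Suc numeral_eq_Suc) blast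

lemma mosaic_board:
  assumes "conn p = UNIV" "conn q = UNIV" "conn r = UNIV" "conn s = UNIV"
  shows "mosaic 4 (board p q r s)"
  unfolding mosaic_def suitably_connected_def all_less_4 using assms
  by (simp add: board_def eval_nat_numeral)

lemma strands_before_simps:
  "strands_before M i 0 = 0"
  "strands_before M i (Suc j) = strands_before M i j + (if Bottom \<in> conn (M i j) then 1 else 0)"
proof -
  have "{j'. j' < Suc j \<and> Bottom \<in> conn (M i j')} =
      {j'. j' < j \<and> Bottom \<in> conn (M i j')} \<union> (if Bottom \<in> conn (M i j) then {j} else {})"
    by (auto simp: less_Suc_eq)
  then show "strands_before M i (Suc j) = strands_before M i j + (if Bottom \<in> conn (M i j) then 1 else 0)"
    by (simp add: strands_before_def)
qed (simp add: strands_before_def)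

text \<open>
  The frame contributes two maxima and two minima.  Turned by 45 degrees, the inner tiles are arranged
  in a diamond with \<open>p\<close> on top, \<open>q\<close> on the right, \<open>r\<close> on the left and \<open>s\<close> at the bottom.
\<close>

lemma mosaic_diagram_board:
  assumes "conn p = UNIV" "conn q = UNIV" "conn r = UNIV" "conn s = UNIV"
  shows "mosaic_diagram 4 (board p q r s) = [(Birth, 0), (Birth, 0)] @
    map (\<lambda>a. (a, 1)) (tile_events p) @ map (\<lambda>a. (a, 2)) (tile_events q) @
    map (\<lambda>a. (a, 0)) (tile_events r) @ map (\<lambda>a. (a, 1)) (tile_events s) @ [(Death, 2), (Death, 0)]"
  unfolding mosaic_diagram_def using assms
  by (simp add: board_def eval_nat_numeral strands_before_simps)

lemma tiles_board: "mosaic_tile_number 4 (board p q r s) \<le> 12"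
proof -
  have "{(i, j). i < 4 \<and> j < 4 \<and> board p q r s i j \<noteq> T0} \<subseteq>
      {..<4} \<times> {..<4} - {(0, 0), (0, 3), (3, 0), (3, 3)}"
    by (auto simp: board_def)
  then have "mosaic_tile_number 4 (board p q r s) \<le>
      card ({..<4} \<times> {..<4} - {(0, 0), (0, 3), (3, 0), (3 :: nat, 3 :: nat)})"
    unfolding mosaic_tile_number_def by (intro card_mono) auto
  also have "\<dots> = 12" by (subst card_Diff_subset) auto
  finally show ?thesis .
qed

lemma represents_board:
  assumes "conn p = UNIV" "conn q = UNIV" "conn r = UNIV" "conn s = UNIV"
    and "equivclp move (mosaic_diagram 4 (board p q r s)) D"
    and "link_diagram (mosaic_diagram 4 (board p q r s))"
  shows "represents 4 (board p q r s) (link_of D)"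
  unfolding represents_def link_of_def using mosaic_board[OF assms(1-4)] assms(5,6)
  by (auto intro: equivclp_sym)

lemma hopf_board: "represents 4 (board (crossing_tile (\<not> b)) T7 T7 (crossing_tile (\<not> b))) (hopf_link b)"
proof -
  let ?D = "mosaic_diagram 4 (board (crossing_tile (\<not> b)) T7 T7 (crossing_tile (\<not> b)))"
  have D: "?D = [(Birth, 0), (Birth, 0), (Cross (\<not> b), 1)] @ [] @ [(Cross (\<not> b), 1), (Death, 2), (Death, 0)]"
    by (subst mosaic_diagram_board) (simp_all add: UNIV_side)
  have "equivclp move ?D ([(Birth, 0), (Birth, 1), (Cross b, 0)] @ [] @ [(Cross b, 2), (Death, 1), (Death, 0)])"
    unfolding D by (rule ring_of_crossings) simp
  also have "equivclp move \<dots> (closed_2_braid b 2)"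
    using collect_twist[of "[(Death, 1), (Death, 0)]" 1 b]
    by (simp add: closed_2_braid_def numeral_2_eq_2)
  finally show ?thesis
    unfolding hopf_link_def by (intro represents_board) (simp_all add: D link_diagram_def UNIV_side)
qed

lemma trefoil_board:
  "represents 4 (board (crossing_tile (\<not> b)) (crossing_tile b) T7 (crossing_tile (\<not> b))) (trefoil_knot b)"
proof -
  let ?D = "mosaic_diagram 4 (board (crossing_tile (\<not> b)) (crossing_tile b) T7 (crossing_tile (\<not> b)))"
  have D: "?D = [(Birth, 0), (Birth, 0), (Cross (\<not> b), 1)] @ [(Cross b, 2)] @
      [(Cross (\<not> b), 1), (Death, 2), (Death, 0)]"
    by (subst mosaic_diagram_board) (simp_all add: UNIV_side)
  have "equivclp move ?D ([(Birth, 0), (Birth, 1), (Cross b, 0)] @ [(Cross b, 2)] @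
      [(Cross b, 2), (Death, 1), (Death, 0)])"
    unfolding D by (rule ring_of_crossings) simp
  also have "equivclp move \<dots>
      ([(Birth, 0), (Birth, 1)] @ replicate 2 (Cross b, 0) @ [(Cross b, 2), (Death, 1), (Death, 0)])"
    using collect_twist[of "[(Cross b, 2), (Death, 1), (Death, 0)]" 1 b] by (simp add: numeral_2_eq_2)
  also have "equivclp move \<dots> (closed_2_braid b 3)"
    using collect_twist[of "[(Death, 1), (Death, 0)]" 2 b]
    by (simp add: closed_2_braid_def numeral_3_eq_3 numeral_2_eq_2)
  finally show ?thesis
    unfolding trefoil_knot_def by (intro represents_board) (simp_all add: D link_diagram_def UNIV_side)
qed

lemma solomon_board:
  "represents 4 (board (crossing_tile (\<not> b)) (crossing_tile b) (crossing_tile b) (crossing_tile (\<not> b)))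
     (solomon_knot b)"
proof -
  let ?D = "mosaic_diagram 4
    (board (crossing_tile (\<not> b)) (crossing_tile b) (crossing_tile b) (crossing_tile (\<not> b)))"
  have D: "?D = [(Birth, 0), (Birth, 0), (Cross (\<not> b), 1)] @ [(Cross b, 2), (Cross b, 0)] @
      [(Cross (\<not> b), 1), (Death, 2), (Death, 0)]"
    by (subst mosaic_diagram_board) (simp_all add: UNIV_side)
  have "equivclp move ?D ([(Birth, 0), (Birth, 1), (Cross b, 0)] @ [(Cross b, 2), (Cross b, 0)] @
      [(Cross b, 2), (Death, 1), (Death, 0)])"
    unfolding D by (rule ring_of_crossings) simp
  also have "equivclp move \<dots>
      ([(Birth, 0), (Birth, 1)] @ replicate 3 (Cross b, 0) @ [(Cross b, 2), (Death, 1), (Death, 0)])"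
    using collect_twist[of "[(Cross b, 0), (Cross b, 2), (Death, 1), (Death, 0)]" 1 b]
    by (simp add: numeral_3_eq_3)
  also have "equivclp move \<dots> (closed_2_braid b 4)"
    using collect_twist[of "[(Death, 1), (Death, 0)]" 3 b]
    by (simp add: closed_2_braid_def eval_nat_numeral)
  finally show ?thesis
    unfolding solomon_knot_def by (intro represents_board) (simp_all add: D link_diagram_def UNIV_side)
qed

section \<open>Tile numbers\<close>

text \<open>
  A mosaic of side at most three has at most nine tiles, so the lower bound also determines the mosaic
  number.
\<close>

lemma tile_numbers_eq_12:
  assumes lower: "\<And>n M. represents n M K \<Longrightarrow> 12 \<le> mosaic_tile_number n M"
    and M: "represents 4 M K" "mosaic_tile_number 4 M = 12"
  shows "tile_number K = 12 \<and> minimal_mosaic_tile_number K = 12"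
proof -
  have "mosaic_number K = 4"
    unfolding mosaic_number_def
  proof (rule Least_equality)
    show "\<exists>M. represents 4 M K" using M(1) by blast
    fix n assume "\<exists>M. represents n M K"
    then obtain N where N: "represents n N K" by blast
    have "mosaic_tile_number n N \<le> card ({..<n} \<times> {..<n})"
      unfolding mosaic_tile_number_def by (rule card_mono) auto
    then have "12 \<le> n * n" using lower[OF N] by simp
    then show "4 \<le> n" using mult_le_mono[of n 3 n 3] by linarith
  qed
  moreover have "tile_number K = 12"
    unfolding tile_number_def by (rule Least_equality) (use M lower in auto)
  moreover have "(LEAST t. \<exists>M. represents 4 M K \<and> mosaic_tile_number 4 M = t) = 12"
    by (rule Least_equality) (use M lower in auto)
  ultimately show ?thesis by (simp add: minimal_mosaic_tile_number_def)
qed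

theorem corollary12:
  fixes b :: bool
  shows "(tile_number (trefoil_knot b) = 12 \<and>
          tile_number (hopf_link b) = 12 \<and>
          tile_number (solomon_knot b) = 12) \<and>
         (minimal_mosaic_tile_number (trefoil_knot b) = 12 \<and>
          minimal_mosaic_tile_number (hopf_link b) = 12 \<and>
          minimal_mosaic_tile_number (solomon_knot b) = 12)"
  using tile_numbers_eq_12[OF _ hopf_board] tile_numbers_eq_12[OF _ trefoil_board]
    tile_numbers_eq_12[OF _ solomon_board] twelve_tiles_links tiles_board hopf_board trefoil_board solomon_board
  by (metis order_antisym)

end
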